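(* Let $\{x_t\}_{t=0}^T$ be generated by the ZO-ProxSAGA algorithm using the coordinate smoothing gradient estimator (CooSGE) with smoothing parameter $\mu>0$ (algorithm, estimator and assumptions as in the context), and define a positive sequence $\{c_t\}$ by $$c_t=\frac{L^2d\,\eta}{b}+c_{t+1}(1-p)(1+\beta),\qquad c_T=0,$$ where $\beta>0$. Let $\eta=\frac{\rho}{Ld}$ with $0<\rho<\frac12$, and suppose $b$ satisfies $$\frac{32\rho^2n^2}{b^3}+\rho\le1 .$$ Let $\gamma=\frac\eta2-L\eta^2$ and let $x_*$ be an optimal solution of $\min_{x\in\mathbb{R}^d}F(x)$. Then, for the output iterate $x$ drawn uniformly at random from $\{x_t:0\le t\le T-1\}$, $$\mathbb{E}\|g_\eta(x)\|^2=\frac1T\sum_{t=0}^{T-1}\mathbb{E}\|g_\eta(x_t)\|^2\le\frac{\mathbb{E}[F(x_0)-F(x_* )]}{T\gamma}+\frac{L^2d^2\mu^2\eta}{4\gamma}.$$ If further $b=[n^{2/3}]$, $\rho=\frac18$ and $\mu=O\big(\frac1{\sqrt{dT}}\big)$, then $$\mathbb{E}\|g_\eta(x)\|^2\le\frac{64dL\,\mathbb{E}[F(x_0)-F(x_* )]}{3T}+O\Big(\frac dT\Big),$$ where the constant in $O(d/T)$ depends only on $L$ and on the constant in $\mu=O(1/\sqrt{dT})$.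
   Context: Problem: minimize $F(x)=f(x)+\psi(x)$ over $x\in\mathbb{R}^d$, with $f(x)=\frac1n\sum_{i=1}^n f_i(x)$, each $f_i:\mathbb{R}^d\to\mathbb{R}$ differentiable and possibly nonconvex, and $\psi$ a convex, possibly nonsmooth function. Standing assumptions: (1) for every $i$, $\|\nabla f_i(x)-\nabla f_i(y)\|\le L\|x-y\|$ for all $x,y\in\mathbb{R}^d$, with $L>0$; (2) $\|\nabla f_i(x)\|^2\le\sigma^2$ for all $x$ and all $i$. Proximal operator: $\mathrm{Prox}_{\eta\psi}(x)=\arg\min_{y\in\mathbb{R}^d}\{\psi(y)+\frac1{2\eta}\|y-x\|^2\}$. Gradient mapping: $g_\eta(x)=\frac1\eta\big(x-\mathrm{Prox}_{\eta\psi}(x-\eta\nabla f(x))\big)$. CooSGE with parameter $\mu>0$ (all coordinate parameters $\mu_j=\mu$): $\hat\nabla f_i(x)=\sum_{j=1}^d\frac{f_i(x+\mu e_j)-f_i(x-\mu e_j)}{2\mu}e_j$, where $e_j$ are the standard basis vectors. ZO-ProxSAGA algorithm: inputs are mini-batch size $b\in\{1,\dots,n\}$, number of iterations $T$, step size $\eta>0$; initialize $x_0\in\mathbb{R}^d$, $z^0_i=x_0$ for $i=1,\dots,n$, $\hat\phi_0=\frac1n\sum_{i=1}^n\hat\nabla f_i(z^0_i)$. For $t=0,\dots,T-1$: pick uniformly at random, with replacement and independently of the past, a mini-batch $\mathcal I_t$ of $b$ indices from $\{1,\dots,n\}$; set $\hat v_t=\frac1b\sum_{i_t\in\mathcal I_t}\big(\hat\nabla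 f_{i_t}(x_t)-\hat\nabla f_{i_t}(z^t_{i_t})\big)+\hat\phi_t$ and $x_{t+1}=\mathrm{Prox}_{\eta\psi}(x_t-\eta\hat v_t)$; set $z^{t+1}_i=x_t$ for $i\in\mathcal I_t$ and $z^{t+1}_i=z^t_i$ for $i\notin\mathcal I_t$; update $\hat\phi_{t+1}=\frac1n\sum_{i=1}^n\hat\nabla f_i(z^{t+1}_i)$. $p=1-(1-\frac1n)^b$ is the probability that a given index $i$ belongs to $\mathcal I_t$. $[\cdot]$ denotes integer part. $\mathbb{E}$ is expectation over all the randomness. In the "further" part all earlier hypotheses (including the inequality on $b$) remain in force. *)

theory Defs
  imports "HOL-Probability.Probability"
begin

(* The O-constant in the theorem must not depend on the dimension d, so d has to be
   a bound natural number rather than the cardinality of an index type.  All spaces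
   R^d are therefore carried by one inner product type, the finitely supported
   sequences; R^d is the subspace of sequences supported in {1..d}.  (The library's
   instances for nat \<Rightarrow>\<^sub>0 real cannot serve here, they use the 1-norm.) *)

typedef rvec = "{x :: nat \<Rightarrow> real. finite {j. x j \<noteq> 0}}"
  morphisms coord Abs_rvec
  by (rule exI[of _ "\<lambda>_. 0"]) simp

setup_lifting type_definition_rvec

lemma finite_support: "finite {j. coord x j \<noteq> 0}"
  using coord[of x] by simp

lemma rvec_eqI: "(\<And>j. coord x j = coord y j) \<Longrightarrow> x = y"
  by (simp add: coord_inject[symmetric] fun_eq_iff)

instantiation rvec :: real_vector
begin

lift_definition zero_rvec :: rvec is "\<lambda>_. 0"
  by simp

lift_definition plus_rvec :: "rvec \<Rightarrow> rvec \<Rightarrow> rvec" is "\<lambda>x y j. x j + y j"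
  subgoal for x y
    by (rule finite_subset[of _ "{j. x j \<noteq> 0} \<union> {j. y j \<noteq> 0}"]) auto
  done

lift_definition minus_rvec :: "rvec \<Rightarrow> rvec \<Rightarrow> rvec" is "\<lambda>x y j. x j - y j"
  subgoal for x y
    by (rule finite_subset[of _ "{j. x j \<noteq> 0} \<union> {j. y j \<noteq> 0}"]) auto
  done

lift_definition uminus_rvec :: "rvec \<Rightarrow> rvec" is "\<lambda>x j. - x j"
  by simp

lift_definition scaleR_rvec :: "real \<Rightarrow> rvec \<Rightarrow> rvec" is "\<lambda>c x j. c * x j"
  by (erule finite_subset[rotated]) auto

instance
  by standard (transfer, simp add: fun_eq_iff algebra_simps)+

end

lemma coord_simps [simp]:
  "coord 0 j = 0"
  "coord (x + y) j = coord x j + coord y j"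
  "coord (x - y) j = coord x j - coord y j"
  "coord (- x) j = - coord x j"
  "coord (c *\<^sub>R x) j = c * coord x j"
  by (transfer, simp)+

instantiation rvec :: real_inner
begin

definition inner_rvec :: "rvec \<Rightarrow> rvec \<Rightarrow> real"
  where "x \<bullet> y = (\<Sum>j | coord x j \<noteq> 0. coord x j * coord y j)"

definition norm_rvec :: "rvec \<Rightarrow> real"
  where "norm x = sqrt (x \<bullet> x)" for x :: rvec

definition dist_rvec :: "rvec \<Rightarrow> rvec \<Rightarrow> real"
  where "dist x y = norm (x - y)" for x y :: rvec

definition sgn_rvec :: "rvec \<Rightarrow> rvec"
  where "sgn x = x /\<^sub>R norm x" for x :: rvec

definition uniformity_rvec :: "(rvec \<times> rvec) filter"
  where "uniformity = (INF e\<in>{0<..}. principal {(x :: rvec, y). dist x y < e})"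

definition open_rvec :: "rvec set \<Rightarrow> bool"
  where "open U \<longleftrightarrow> (\<forall>x\<in>U. \<forall>\<^sub>F (x', y) in uniformity. x' = x \<longrightarrow> y \<in> U)"
  for U :: "rvec set"

lemma inner_rvec_superset:
  assumes "finite A" "{j. coord x j \<noteq> 0} \<subseteq> A"
  shows "x \<bullet> y = (\<Sum>j\<in>A. coord x j * coord y j)"
  unfolding inner_rvec_def
  by (rule sum.mono_neutral_left) (use assms in auto)

instance
proof
  fix x y z :: rvec and r :: real
  let ?A = "{j. coord x j \<noteq> 0} \<union> {j. coord y j \<noteq> 0}"
  have A: "finite ?A"
    by (simp add: finite_support)
  show "dist x y = norm (x - y)" by (fact dist_rvec_def)
  show "sgn x = x /\<^sub>R norm x" by (fact sgn_rvec_def)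
  show "uniformity = (INF e\<in>{0<..}. principal {(x :: rvec, y). dist x y < e})"
    by (fact uniformity_rvec_def)
  show "open U \<longleftrightarrow> (\<forall>x\<in>U. \<forall>\<^sub>F (x', y) in uniformity. x' = x \<longrightarrow> y \<in> U)"
    for U :: "rvec set"
    by (fact open_rvec_def)
  show "x \<bullet> y = y \<bullet> x"
    by (subst (1 2) inner_rvec_superset[OF A]) (auto simp: mult.commute)
  show "(x + y) \<bullet> z = x \<bullet> z + y \<bullet> z"
    by (subst (1 2 3) inner_rvec_superset[OF A]) (auto simp: algebra_simps sum.distrib)
  show "(r *\<^sub>R x) \<bullet> y = r * (x \<bullet> y)"
    by (subst (1 2) inner_rvec_superset[OF A]) (auto simp: algebra_simps sum_distrib_left)
  show "0 \<le> x \<bullet> x"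
    by (simp add: inner_rvec_def sum_nonneg)
  show "x \<bullet> x = 0 \<longleftrightarrow> x = 0"
  proof
    assume "x \<bullet> x = 0"
    then have "\<forall>j\<in>{j. coord x j \<noteq> 0}. coord x j * coord x j = 0"
      unfolding inner_rvec_def
      by (subst (asm) sum_nonneg_eq_0_iff) (auto simp: finite_support)
    then show "x = 0"
      by (auto intro!: rvec_eqI)
  qed (simp add: inner_rvec_def)
  show "norm x = sqrt (x \<bullet> x)" by (fact norm_rvec_def)
qed

end

definition Rn :: "nat \<Rightarrow> rvec set"
  where "Rn d = {x. \<forall>j. j \<notin> {1..d} \<longrightarrow> coord x j = 0}"

lift_definition basis_vec :: "nat \<Rightarrow> rvec" is "\<lambda>j k. if k = j then 1 else 0"
  by simp

lemma inner_Rn: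
  assumes "x \<in> Rn d"
  shows "x \<bullet> y = (\<Sum>j=1..d. coord x j * coord y j)"
  by (rule inner_rvec_superset) (use assms in \<open>auto simp: Rn_def\<close>)

lemma norm_Rn: "x \<in> Rn d \<Longrightarrow> norm x = sqrt (\<Sum>j=1..d. (coord x j)\<^sup>2)"
  by (simp add: norm_rvec_def inner_Rn power2_eq_square)

lemma coord_basis_vec [simp]: "coord (basis_vec j) k = (if k = j then 1 else 0)"
  by transfer simp

(* Functions on R^d are functions on the whole carrier type of which only the values
   on Rn d are used; differentiability is relative to Rn d.  The requirement
   g \<in> Rn d is what makes the gradient unique. *)

definition gradient :: "nat \<Rightarrow> (rvec \<Rightarrow> real) \<Rightarrow> rvec \<Rightarrow> rvec"
  where "gradient d h x =
    (THE g. g \<in> Rn d \<and> (h has_derivative (\<lambda>v. g \<bullet> v)) (at x within Rn d))"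

definition mean :: "nat \<Rightarrow> (nat \<Rightarrow> rvec \<Rightarrow> real) \<Rightarrow> rvec \<Rightarrow> real"
  where "mean n f x = (\<Sum>i=1..n. f i x) / real n"

definition objective :: "nat \<Rightarrow> (nat \<Rightarrow> rvec \<Rightarrow> real) \<Rightarrow> (rvec \<Rightarrow> real) \<Rightarrow> rvec \<Rightarrow> real"
  where "objective n f \<psi> x = mean n f x + \<psi> x"

definition standing_assumptions ::
  "nat \<Rightarrow> nat \<Rightarrow> (nat \<Rightarrow> rvec \<Rightarrow> real) \<Rightarrow> (rvec \<Rightarrow> real) \<Rightarrow> real \<Rightarrow> real \<Rightarrow> bool"
  where "standing_assumptions d n f \<psi> L \<sigma> \<longleftrightarrow>
    1 \<le> d \<and> 1 \<le> n \<and> 0 < L \<and>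
    convex_on (Rn d) \<psi> \<and>
    (\<forall>i\<in>{1..n}. \<forall>x\<in>Rn d. f i differentiable (at x within Rn d)) \<and>
    (\<forall>i\<in>{1..n}. \<forall>x\<in>Rn d. \<forall>y\<in>Rn d.
      norm (gradient d (f i) x - gradient d (f i) y) \<le> L * norm (x - y)) \<and>
    (\<forall>i\<in>{1..n}. \<forall>x\<in>Rn d. (norm (gradient d (f i) x))\<^sup>2 \<le> \<sigma>\<^sup>2)"

definition prox :: "nat \<Rightarrow> real \<Rightarrow> (rvec \<Rightarrow> real) \<Rightarrow> rvec \<Rightarrow> rvec"
  where "prox d \<eta> \<psi> x =
    arg_min (\<lambda>y. \<psi> y + 1 / (2 * \<eta>) * (norm (y - x))\<^sup>2) (\<lambda>y. y \<in> Rn d)"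

definition gradient_mapping ::
  "nat \<Rightarrow> nat \<Rightarrow> (nat \<Rightarrow> rvec \<Rightarrow> real) \<Rightarrow> (rvec \<Rightarrow> real) \<Rightarrow> real \<Rightarrow> rvec \<Rightarrow> rvec"
  where "gradient_mapping d n f \<psi> \<eta> x =
    (1 / \<eta>) *\<^sub>R (x - prox d \<eta> \<psi> (x - \<eta> *\<^sub>R gradient d (mean n f) x))"

definition coosge :: "nat \<Rightarrow> real \<Rightarrow> (rvec \<Rightarrow> real) \<Rightarrow> rvec \<Rightarrow> rvec"
  where "coosge d \<mu> h x =
    (\<Sum>j=1..d. ((h (x + \<mu> *\<^sub>R basis_vec j) - h (x - \<mu> *\<^sub>R basis_vec j)) / (2 * \<mu>)) *\<^sub>R basis_vec j)"

(* The whole state (x_t, z^t) after t iterations, as a function of the list Is of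
   mini-batches.  A mini-batch is a list of indices, possibly with repetitions. *)

primrec zo_proxsaga ::
  "nat \<Rightarrow> nat \<Rightarrow> nat \<Rightarrow> (nat \<Rightarrow> rvec \<Rightarrow> real) \<Rightarrow> (rvec \<Rightarrow> real) \<Rightarrow> real \<Rightarrow> real \<Rightarrow> rvec \<Rightarrow>
    nat list list \<Rightarrow> nat \<Rightarrow> rvec \<times> (nat \<Rightarrow> rvec)"
  where
    "zo_proxsaga d n b f \<psi> \<mu> \<eta> x0 Is 0 = (x0, \<lambda>i. x0)"
  | "zo_proxsaga d n b f \<psi> \<mu> \<eta> x0 Is (Suc t) =
      (let (x, z) = zo_proxsaga d n b f \<psi> \<mu> \<eta> x0 Is t;
           \<phi> = (1 / real n) *\<^sub>R (\<Sum>i=1..n. coosge d \<mu> (f i) (z i));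
           v = (1 / real b) *\<^sub>R (\<Sum>i\<leftarrow>Is ! t. coosge d \<mu> (f i) x - coosge d \<mu> (f i) (z i)) + \<phi>
       in (prox d \<eta> \<psi> (x - \<eta> *\<^sub>R v), \<lambda>i. if i \<in> set (Is ! t) then x else z i))"

abbreviation iterate ::
  "nat \<Rightarrow> nat \<Rightarrow> nat \<Rightarrow> (nat \<Rightarrow> rvec \<Rightarrow> real) \<Rightarrow> (rvec \<Rightarrow> real) \<Rightarrow> real \<Rightarrow> real \<Rightarrow> rvec \<Rightarrow>
    nat list list \<Rightarrow> nat \<Rightarrow> rvec"
  where "iterate d n b f \<psi> \<mu> \<eta> x0 Is t \<equiv> fst (zo_proxsaga d n b f \<psi> \<mu> \<eta> x0 Is t)"

definition batches_pmf :: "nat \<Rightarrow> nat \<Rightarrow> nat \<Rightarrow> nat list list pmf"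
  where "batches_pmf n b T = replicate_pmf T (replicate_pmf b (pmf_of_set {1..n}))"

definition output_pmf ::
  "nat \<Rightarrow> nat \<Rightarrow> nat \<Rightarrow> nat \<Rightarrow> (nat \<Rightarrow> rvec \<Rightarrow> real) \<Rightarrow> (rvec \<Rightarrow> real) \<Rightarrow> real \<Rightarrow> real \<Rightarrow> rvec \<Rightarrow>
    rvec pmf"
  where "output_pmf d n b T f \<psi> \<mu> \<eta> x0 =
    map_pmf (\<lambda>(Is, t). iterate d n b f \<psi> \<mu> \<eta> x0 Is t)
      (pair_pmf (batches_pmf n b T) (pmf_of_set {..<T}))"

end

theory Submission
  imports Defs
begin

text \<open>
  Let \<open>v\<^sub>t\<close> be the search direction in iteration \<open>t\<close>. The three-point inequality for the proximal
  operator, applied both to the step taken and to the exact proximal gradient step, gives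
  \<open>F(x\<^sub>t\<^sub>+\<^sub>1) \<le> F(x\<^sub>t) - \<eta>/2 \<parallel>g(x\<^sub>t)\<parallel>\<^sup>2 - (1/(2\<eta>) - L/2) \<parallel>x\<^sub>t\<^sub>+\<^sub>1 - x\<^sub>t\<parallel>\<^sup>2 + \<eta>/2 \<parallel>v\<^sub>t - \<nabla>f(x\<^sub>t)\<parallel>\<^sup>2\<close>.
  Given the past, the expectation of the last norm splits exactly into the squared bias of the
  coordinate estimator, at most \<open>L\<^sup>2 d \<mu>\<^sup>2 / 4\<close>, and a variance of at most
  \<open>L\<^sup>2 d / (b n) \<Sum>\<^sub>i \<parallel>x\<^sub>t - z\<^sub>i\<parallel>\<^sup>2\<close>. The variance is absorbed by the Lyapunov function
  \<open>F(x) + c/n \<Sum>\<^sub>i \<parallel>x - z\<^sub>i\<parallel>\<^sup>2\<close>, and the descent telescopes. The bound does not mention \<open>\<beta>\<close> and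
  \<open>c\<^sub>t\<close>, so Young's parameter may be taken as \<open>b / (4n)\<close> and the weight \<open>c\<close> constant in \<open>t\<close>.
\<close>

subsection \<open>The subspaces \<open>Rn d\<close>\<close>

lemma subspace_Rn: "subspace (Rn d)"
  by (auto simp: subspace_def Rn_def)

lemma Rn_closed [simp, intro]:
  "0 \<in> Rn d"
  "x \<in> Rn d \<Longrightarrow> y \<in> Rn d \<Longrightarrow> x + y \<in> Rn d"
  "x \<in> Rn d \<Longrightarrow> y \<in> Rn d \<Longrightarrow> x - y \<in> Rn d"
  "x \<in> Rn d \<Longrightarrow> c *\<^sub>R x \<in> Rn d"
  "(\<And>i. i \<in> A \<Longrightarrow> F i \<in> Rn d) \<Longrightarrow> sum F A \<in> Rn d"
  by (auto intro: subspace_0 subspace_add subspace_diff subspace_scale subspace_sum subspace_Rn)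

lemma basis_vec_in_Rn [simp]: "basis_vec j \<in> Rn d \<longleftrightarrow> j \<in> {1..d}"
  by (auto simp: Rn_def)

lemma convex_Rn: "convex (Rn d)"
  by (simp add: subspace_Rn subspace_imp_convex)

lemma coord_sum: "coord (sum F A) k = (\<Sum>i\<in>A. coord (F i) k)"
  by (induction A rule: infinite_finite_induct) auto

lemma inner_basis_vec: "x \<bullet> basis_vec j = coord x j"
proof -
  have "basis_vec j \<bullet> x = (\<Sum>k\<in>{j}. coord (basis_vec j) k * coord x k)"
    by (rule inner_rvec_superset) auto
  then show ?thesis
    by (simp add: inner_commute)
qed

lemma norm_basis_vec [simp]: "norm (basis_vec j) = 1"
  by (simp add: norm_eq_sqrt_inner inner_basis_vec)

lemma abs_coord_le_norm: "\<bar>coord x j\<bar> \<le> norm x"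
  using Cauchy_Schwarz_ineq2[of x "basis_vec j"] by (simp add: inner_basis_vec)

text \<open>The dimension factor \<open>d\<close> in the estimates for the coordinate estimator
  enters here: bounds that hold one coordinate at a time are added up.\<close>

lemma norm2_Rn_le:
  assumes "x \<in> Rn d" and "\<And>j. j \<in> {1..d} \<Longrightarrow> \<bar>coord x j\<bar> \<le> r"
  shows "(norm x)\<^sup>2 \<le> real d * r\<^sup>2"
proof -
  have "(norm x)\<^sup>2 = (\<Sum>j=1..d. (coord x j)\<^sup>2)"
    by (simp add: norm_Rn[OF assms(1)] sum_nonneg)
  also have "\<dots> \<le> (\<Sum>j=1..d. r\<^sup>2)"
    by (intro sum_mono) (metis abs_ge_zero assms(2) power2_abs power_mono)
  finally show ?thesis by simp
qed

text \<open>The orthogonal projection onto \<open>Rn d\<close>. Precomposing with it extends a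
  function from \<open>Rn d\<close>, which has empty interior, to the whole carrier, where results
  about open sets apply.\<close>

definition Rn_proj :: "nat \<Rightarrow> rvec \<Rightarrow> rvec"
  where "Rn_proj d x = (\<Sum>j=1..d. coord x j *\<^sub>R basis_vec j)"

lemma coord_Rn_proj: "coord (Rn_proj d x) k = (if k \<in> {1..d} then coord x k else 0)"
  by (simp add: Rn_proj_def coord_sum if_distrib[of "(*) _"] sum.delta cong: if_cong)

lemma Rn_proj_in [simp]: "Rn_proj d x \<in> Rn d"
  by (auto simp: Rn_def coord_Rn_proj)

lemma Rn_proj_id: "x \<in> Rn d \<Longrightarrow> Rn_proj d x = x"
  by (rule rvec_eqI) (auto simp: coord_Rn_proj Rn_def)

lemma Rn_0: "Rn 0 = {0}"
  by (auto simp: Rn_def intro: rvec_eqI)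

text \<open>The carrier is infinite-dimensional, so closed bounded sets need not be compact.
  Induction on \<open>d\<close> works instead: a box is the continuous image of the product of a box
  one dimension lower and an interval.\<close>

lemma compact_Rn_box: "compact {x \<in> Rn d. \<forall>j. \<bar>coord x j\<bar> \<le> r}"
proof (induction d)
  case 0
  have "{x \<in> Rn 0. \<forall>j. \<bar>coord x j\<bar> \<le> r} \<subseteq> {0}"
    by (auto simp: Rn_0)
  then show ?case
    by (intro finite_imp_compact finite_subset[OF _ finite.insertI[OF finite.emptyI]])
next
  case (Suc d)
  let ?B = "\<lambda>d. {x \<in> Rn d. \<forall>j. \<bar>coord x j\<bar> \<le> r}"
  have "?B (Suc d) = (\<lambda>(x, s). x + s *\<^sub>R basis_vec (Suc d)) ` (?B d \<times> {-r..r})"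
  proof (intro equalityI subsetI)
    fix x assume x: "x \<in> ?B (Suc d)"
    let ?s = "coord x (Suc d)"
    have r: "\<bar>?s\<bar> \<le> r"
      using x by blast
    have "x - ?s *\<^sub>R basis_vec (Suc d) \<in> ?B d"
      using x r by (auto simp: Rn_def not_le le_Suc_eq)
    moreover have "?s \<in> {-r..r}"
      using r by auto
    ultimately show "x \<in> (\<lambda>(x, s). x + s *\<^sub>R basis_vec (Suc d)) ` (?B d \<times> {-r..r})"
      by (intro image_eqI[where x="(x - ?s *\<^sub>R basis_vec (Suc d), ?s)"]) auto
  next
    fix y assume "y \<in> (\<lambda>(x, s). x + s *\<^sub>R basis_vec (Suc d)) ` (?B d \<times> {-r..r})"
    then obtain x s where "x \<in> ?B d" "s \<in> {-r..r}" "y = x + s *\<^sub>R basis_vec (Suc d)"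
      by auto
    then show "y \<in> ?B (Suc d)"
      by (auto simp: Rn_def)
  qed
  moreover have "compact ((\<lambda>(x, s). x + s *\<^sub>R basis_vec (Suc d)) ` (?B d \<times> {-r..r}))"
    by (intro compact_continuous_image compact_Times Suc compact_Icc)
       (auto intro!: continuous_intros simp: split_beta)
  ultimately show ?case
    by simp
qed

lemma compact_Rn_cball: "compact (Rn d \<inter> cball a r)"
proof -
  let ?B = "{x \<in> Rn d. \<forall>j. \<bar>coord x j\<bar> \<le> norm a + r}"
  have "\<bar>coord x j\<bar> \<le> norm a + r" if "x \<in> cball a r" for x j
  proof -
    have "norm x \<le> norm a + norm (a - x)"
      using norm_triangle_sub[of x a] by (simp add: norm_minus_commute)
    with that show ?thesis
      using abs_coord_le_norm[of x j] by (simp add: dist_norm)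
  qed
  then have "Rn d \<inter> cball a r = ?B \<inter> cball a r"
    by auto
  then show ?thesis
    by (simp add: compact_Int_closed compact_Rn_box)
qed

subsection \<open>Convex functions and the proximal operator\<close>

lemma convex_on_Rn_translate:
  assumes "convex_on (Rn d) h" and "a \<in> Rn d"
  shows "convex_on (Rn d) (\<lambda>x. h (a + x))"
proof (rule convex_onI[OF _ convex_Rn])
  fix t :: real and x y
  assume "0 < t" "t < 1" "x \<in> Rn d" "y \<in> Rn d"
  moreover have "a + ((1 - t) *\<^sub>R x + t *\<^sub>R y) = (1 - t) *\<^sub>R (a + x) + t *\<^sub>R (a + y)"
    by (simp add: algebra_simps)
  ultimately show "h (a + ((1 - t) *\<^sub>R x + t *\<^sub>R y)) \<le> (1 - t) * h (a + x) + t * h (a + y)"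
    using convex_onD[OF assms(1), of t "a + x" "a + y"] assms(2) by simp
qed

lemma Rn_mono: "d \<le> e \<Longrightarrow> Rn d \<subseteq> Rn e"
  by (auto simp: Rn_def)

text \<open>A point of the unit box lies on a segment between two opposite faces, each a translate
  of the box one dimension lower; by convexity the larger of the two face bounds serves.\<close>

lemma convex_on_Rn_bounded_above:
  assumes "convex_on (Rn d) h"
  shows "\<exists>M. \<forall>x\<in>Rn d. (\<forall>j. \<bar>coord x j\<bar> \<le> 1) \<longrightarrow> h x \<le> M"
  using assms
proof (induction d arbitrary: h)
  case 0
  then show ?case
    by (auto simp: Rn_0)
next
  case (Suc d)
  let ?e = "basis_vec (Suc d)"
  have sub: "Rn d \<subseteq> Rn (Suc d)"
    by (simp add: Rn_mono)
  have "convex_on (Rn d) (\<lambda>x. h (a + x))" if "a \<in> Rn (Suc d)" for a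
    using convex_on_Rn_translate[OF Suc.prems that] sub convex_Rn by (rule convex_on_subset)
  from Suc.IH[OF this, of ?e] Suc.IH[OF this, of "- 1 *\<^sub>R ?e"] obtain M1 M2
    where M1: "\<And>x. x \<in> Rn d \<Longrightarrow> (\<forall>j. \<bar>coord x j\<bar> \<le> 1) \<Longrightarrow> h (?e + x) \<le> M1"
      and M2: "\<And>x. x \<in> Rn d \<Longrightarrow> (\<forall>j. \<bar>coord x j\<bar> \<le> 1) \<Longrightarrow> h (- 1 *\<^sub>R ?e + x) \<le> M2"
    by (metis Rn_closed(4) atLeastAtMost_iff basis_vec_in_Rn le_add1 order_refl plus_1_eq_Suc)
  have "h x \<le> max M1 M2" if x: "x \<in> Rn (Suc d)" "\<forall>j. \<bar>coord x j\<bar> \<le> 1" for x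
  proof -
    define s where "s = coord x (Suc d)"
    \<comment> \<open>\<open>t = 0\<close> is the face where the last coordinate is -1,
      \<open>t = 1\<close> the face where it is 1.\<close>
    define t where "t = (1 + s) / 2"
    define y where "y = x - s *\<^sub>R ?e"
    have s: "\<bar>s\<bar> \<le> 1"
      using x by (simp add: s_def)
    then have t: "0 \<le> t" "t \<le> 1"
      by (auto simp: t_def)
    have y: "y \<in> Rn d" "\<forall>j. \<bar>coord y j\<bar> \<le> 1"
      using x by (auto simp: y_def s_def Rn_def le_Suc_eq)
    have "x = (1 - t) *\<^sub>R (- 1 *\<^sub>R ?e + y) + t *\<^sub>R (?e + y)"
      by (rule rvec_eqI) (auto simp: y_def t_def field_simps)
    also have "h \<dots> \<le> (1 - t) * h (- 1 *\<^sub>R ?e + y) + t * h (?e + y)"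
    proof (rule convex_onD[OF Suc.prems t])
      have "?e \<in> Rn (Suc d)"
        by simp
      then show "- 1 *\<^sub>R ?e + y \<in> Rn (Suc d)" "?e + y \<in> Rn (Suc d)"
        using y(1) sub by blast+
    qed
    also have "\<dots> \<le> (1 - t) * max M1 M2 + t * max M1 M2"
      using M1[OF y] M2[OF y] t by (intro add_mono mult_left_mono) auto
    also have "\<dots> = max M1 M2"
      by (simp add: algebra_simps)
    finally show ?thesis .
  qed
  then show ?case
    by blast
qed

text \<open>A convex function that is bounded near a point is continuous there. The upper bound
  comes from the unit box around \<open>a\<close>, the lower one from reflection in
  \<open>a\<close>.\<close>

lemma convex_on_Rn_continuous:
  assumes h: "convex_on (Rn d) h"
  shows "continuous_on (Rn d) h"
proof -
  let ?h = "\<lambda>x. h (Rn_proj d x)"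
  have lin: "Rn_proj d ((1 - t) *\<^sub>R x + t *\<^sub>R y) = (1 - t) *\<^sub>R Rn_proj d x + t *\<^sub>R Rn_proj d y"
    for t x y
    by (rule rvec_eqI) (auto simp: coord_Rn_proj)
  have cvx: "convex_on S ?h" if "convex S" for S
    by (rule convex_onI[OF _ that]) (use convex_onD[OF h] lin in auto)
  have "isCont ?h a" if a: "a \<in> Rn d" for a
  proof -
    obtain M where M: "\<And>x. x \<in> Rn d \<Longrightarrow> (\<forall>j. \<bar>coord x j\<bar> \<le> 1) \<Longrightarrow> h (a + x) \<le> M"
      using convex_on_Rn_bounded_above[OF convex_on_Rn_translate[OF h a]] by metis
    \<comment> \<open>The factor \<open>c\<close> treats the projected point (\<open>c = 1\<close>)
      and its mirror image in \<open>a\<close> (\<open>c = -1\<close>) at once.\<close>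
    have up: "h (a + c *\<^sub>R (Rn_proj d x - a)) \<le> M" if "x \<in> ball a 1" "\<bar>c\<bar> = 1" for x c
    proof (rule M)
      show "\<forall>j. \<bar>coord (c *\<^sub>R (Rn_proj d x - a)) j\<bar> \<le> 1"
      proof
        fix j
        have "coord a j = 0" if "j \<notin> {1..d}"
          using a that by (simp add: Rn_def)
        then have "\<bar>coord (c *\<^sub>R (Rn_proj d x - a)) j\<bar> \<le> \<bar>coord (x - a) j\<bar>"
          using that by (auto simp: coord_Rn_proj abs_mult)
        also have "\<dots> \<le> norm (x - a)"
          by (rule abs_coord_le_norm)
        also have "\<dots> \<le> 1"
          using that by (simp add: dist_norm norm_minus_commute)
        finally show "\<bar>coord (c *\<^sub>R (Rn_proj d x - a)) j\<bar> \<le> 1" .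
      qed
    qed (use a in auto)
    have "\<bar>?h x\<bar> \<le> \<bar>M\<bar> + 2 * \<bar>h a\<bar>" if x: "x \<in> ball a 1" for x
    proof -
      let ?p = "Rn_proj d x"
      let ?q = "a + (-1) *\<^sub>R (?p - a)"
      have "a = (1 - 1/2) *\<^sub>R ?p + (1/2) *\<^sub>R ?q"
        by (rule rvec_eqI) (simp add: field_simps)
      moreover have "h \<dots> \<le> (1 - 1/2) * h ?p + (1/2) * h ?q"
        by (rule convex_onD[OF h]) (use a in auto)
      ultimately have "2 * h a \<le> h ?p + h ?q"
        by simp
      moreover have "h ?q \<le> M" "h ?p \<le> M"
        using up[OF x, of "-1"] up[OF x, of 1] by auto
      ultimately show ?thesis
        by linarith
    qed
    then have "continuous_on (ball a 1) ?h"
      by (intro convex_on_bounded_continuous cvx) auto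
    then show ?thesis
      by (simp add: continuous_on_eq_continuous_at)
  qed
  then have "continuous_on (Rn d) ?h"
    by (simp add: continuous_at_imp_continuous_on)
  then show ?thesis
    by (rule continuous_on_eq) (simp add: Rn_proj_id)
qed

text \<open>A convex function that is bounded below on a unit ball falls at most linearly away from
  the centre, so the quadratic term wins outside a large ball; inside it, compactness gives a
  minimum.\<close>

lemma convex_on_Rn_plus_square_attains_min:
  assumes h: "convex_on (Rn d) h" and q: "0 < q" and a: "a \<in> Rn d"
  shows "\<exists>y\<in>Rn d. \<forall>z\<in>Rn d. h y + q * (norm (y - a))\<^sup>2 \<le> h z + q * (norm (z - a))\<^sup>2"
proof -
  let ?\<phi> = "\<lambda>y. h y + q * (norm (y - a))\<^sup>2"
  have cont: "continuous_on (Rn d) h"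
    using h by (rule convex_on_Rn_continuous)
  have "\<exists>x\<in>Rn d \<inter> cball a 1. \<forall>y\<in>Rn d \<inter> cball a 1. h x \<le> h y"
    using a by (intro continuous_attains_inf compact_Rn_cball continuous_on_subset[OF cont]) auto
  then obtain x\<^sub>0 where "\<forall>y\<in>Rn d \<inter> cball a 1. h x\<^sub>0 \<le> h y"
    by blast
  then have m: "h x\<^sub>0 \<le> h y" if "y \<in> Rn d" "norm (y - a) \<le> 1" for y
    using that by (simp add: dist_norm norm_minus_commute)
  define m where "m = h x\<^sub>0"
  note m = m[folded m_def]
  have ma: "m \<le> h a"
    using m[OF a] by simp
  \<comment> \<open>Beyond radius \<open>(h a - m) / q\<close>, the term
    \<open>q * r\<^sup>2\<close> pays for the largest possible drop \<open>r * (h a - m)\<close> of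
    \<open>h\<close>. A radius of at least 1 leaves room on the segment from \<open>a\<close> to
    \<open>z\<close> for the point \<open>?w\<close> at distance 1.\<close>
  define R where "R = max 1 ((h a - m) / q)"
  have "\<exists>x\<in>Rn d \<inter> cball a R. \<forall>y\<in>Rn d \<inter> cball a R. ?\<phi> x \<le> ?\<phi> y"
    using a by (intro continuous_attains_inf compact_Rn_cball continuous_intros
        continuous_on_subset[OF cont]) (auto simp: R_def)
  then obtain y where y: "y \<in> Rn d" "\<And>z. z \<in> Rn d \<Longrightarrow> norm (z - a) \<le> R \<Longrightarrow> ?\<phi> y \<le> ?\<phi> z"
    by (auto simp: dist_norm norm_minus_commute)
  have "?\<phi> y \<le> ?\<phi> z" if z: "z \<in> Rn d" for z
  proof (cases "norm (z - a) \<le> R")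
    case True
    then show ?thesis
      using y(2)[OF z] by simp
  next
    case False
    define r where "r = norm (z - a)"
    have r: "1 < r" "(h a - m) / q < r"
      using False by (auto simp: r_def R_def)
    let ?w = "(1 - 1 / r) *\<^sub>R a + (1 / r) *\<^sub>R z"
    have "?w - a = (1 / r) *\<^sub>R (z - a)"
      by (simp add: algebra_simps)
    then have "norm (?w - a) = 1"
      using r(1) by (simp add: r_def[symmetric])
    then have "m \<le> h ?w"
      using a z by (intro m) auto
    also have "\<dots> \<le> (1 - 1 / r) * h a + (1 / r) * h z"
      using r a z by (intro convex_onD[OF h]) auto
    finally have "r * m \<le> (r - 1) * h a + h z"
      using r by (simp add: field_simps)
    then have "h a - r * (h a - m) \<le> h z"
      by (simp add: algebra_simps)
    moreover have "r * (h a - m) \<le> r * (q * r)"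
      using r q by (intro mult_left_mono) (auto simp: field_simps)
    ultimately have "?\<phi> a \<le> ?\<phi> z"
      by (simp add: r_def[symmetric] power2_eq_square algebra_simps)
    moreover have "?\<phi> y \<le> ?\<phi> a"
      using y(2)[OF a] by (simp add: R_def)
    ultimately show ?thesis
      by linarith
  qed
  with y(1) show ?thesis
    by blast
qed

text \<open>\<open>prox\<close> is a choice among minimizers, so it has its defining properties once
  a minimizer is known to exist.\<close>

lemma
  assumes h: "convex_on (Rn d) \<psi>" and \<eta>: "0 < \<eta>" and a: "a \<in> Rn d"
  shows prox_in_Rn: "prox d \<eta> \<psi> a \<in> Rn d"
    and prox_le: "z \<in> Rn d \<Longrightarrow> \<psi> (prox d \<eta> \<psi> a) + 1 / (2 * \<eta>) * (norm (prox d \<eta> \<psi> a - a))\<^sup>2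
      \<le> \<psi> z + 1 / (2 * \<eta>) * (norm (z - a))\<^sup>2"
proof -
  let ?\<phi> = "\<lambda>y. \<psi> y + 1 / (2 * \<eta>) * (norm (y - a))\<^sup>2"
  obtain y where "y \<in> Rn d" "\<forall>z\<in>Rn d. ?\<phi> y \<le> ?\<phi> z"
    using convex_on_Rn_plus_square_attains_min[OF h _ a, of "1 / (2 * \<eta>)"] \<eta> by auto
  then have "is_arg_min ?\<phi> (\<lambda>y. y \<in> Rn d) y"
    by (simp add: is_arg_min_linorder)
  then have "is_arg_min ?\<phi> (\<lambda>y. y \<in> Rn d) (prox d \<eta> \<psi> a)"
    unfolding prox_def arg_min_def by (rule someI)
  then show "prox d \<eta> \<psi> a \<in> Rn d" "z \<in> Rn d \<Longrightarrow> ?\<phi> (prox d \<eta> \<psi> a) \<le> ?\<phi> z"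
    by (simp_all add: is_arg_min_linorder)
qed

text \<open>The last term expresses the strong convexity of the squared norm; it is the source of
  the extra term in \<open>prox_three_point\<close>.\<close>

lemma norm2_convex_combination:
  fixes u v :: "'a :: real_inner"
  shows "(norm ((1 - t) *\<^sub>R u + t *\<^sub>R v))\<^sup>2
    = (1 - t) * (norm u)\<^sup>2 + t * (norm v)\<^sup>2 - t * (1 - t) * (norm (v - u))\<^sup>2"
  by (simp add: power2_norm_eq_inner algebra_simps inner_commute)

text \<open>The minimizer \<open>y\<close> is compared with points on the segment to
  \<open>z\<close>. Strong convexity leaves a surplus of \<open>t * (1 - t)\<close> times the
  squared distance; dividing by \<open>t\<close> and letting \<open>t\<close> tend to 0 gives the
  claim.\<close>

lemma prox_three_point:
  assumes h: "convex_on (Rn d) \<psi>" and \<eta>: "0 < \<eta>" and a: "a \<in> Rn d" and z: "z \<in> Rn d"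
    and y_def: "y = prox d \<eta> \<psi> a"
  shows "\<psi> y + 1 / (2 * \<eta>) * (norm (y - a))\<^sup>2 + 1 / (2 * \<eta>) * (norm (z - y))\<^sup>2
    \<le> \<psi> z + 1 / (2 * \<eta>) * (norm (z - a))\<^sup>2"
proof -
  let ?q = "1 / (2 * \<eta>)"
  have y: "y \<in> Rn d"
    unfolding y_def using h \<eta> a by (rule prox_in_Rn)
  let ?A = "\<psi> z + ?q * (norm (z - a))\<^sup>2 - (\<psi> y + ?q * (norm (y - a))\<^sup>2)"
  let ?B = "?q * (norm (z - y))\<^sup>2"
  have "(1 - t) * ?B \<le> ?A" if t: "0 < t" "t < 1" for t
  proof -
    let ?w = "(1 - t) *\<^sub>R y + t *\<^sub>R z"
    have w: "?w - a = (1 - t) *\<^sub>R (y - a) + t *\<^sub>R (z - a)"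
      by (simp add: algebra_simps)
    have "\<psi> y + ?q * (norm (y - a))\<^sup>2 \<le> \<psi> ?w + ?q * (norm (?w - a))\<^sup>2"
      unfolding y_def by (rule prox_le[OF h \<eta> a]) (use y z in \<open>auto simp: y_def\<close>)
    also have "\<psi> ?w \<le> (1 - t) * \<psi> y + t * \<psi> z"
      using t y z by (intro convex_onD[OF h]) auto
    also have "(norm (?w - a))\<^sup>2
        = (1 - t) * (norm (y - a))\<^sup>2 + t * (norm (z - a))\<^sup>2 - t * (1 - t) * (norm (z - y))\<^sup>2"
      unfolding w norm2_convex_combination by simp
    finally have "0 \<le> t * (?A - (1 - t) * ?B)"
      by (simp add: algebra_simps diff_divide_distrib add_divide_distrib)
    with t show ?thesis
      by (simp add: zero_le_mult_iff)
  qed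
  then have "\<forall>\<^sub>F t in at_right 0. (1 - t) * ?B \<le> ?A"
    by (auto simp: eventually_at_right_field intro!: exI[of _ 1])
  moreover have "((\<lambda>t. (1 - t) * ?B) \<longlongrightarrow> (1 - 0) * ?B) (at_right 0)"
    by (intro tendsto_intros)
  ultimately have "(1 - 0) * ?B \<le> ?A"
    by (intro tendsto_upperbound) auto
  then show ?thesis
    by simp
qed

subsection \<open>Gradients, smoothness and the coordinate estimator\<close>

text \<open>Reduction to calculus in one variable: the line stays in \<open>Rn d\<close>, so a
  derivative relative to \<open>Rn d\<close> yields an ordinary one along the line.\<close>

lemma has_real_derivative_line:
  assumes h: "(h has_derivative (\<lambda>u. g \<bullet> u)) (at (x + t *\<^sub>R v) within Rn d)"
    and x: "x \<in> Rn d" and v: "v \<in> Rn d"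
  shows "((\<lambda>s. h (x + s *\<^sub>R v)) has_real_derivative g \<bullet> v) (at t)"
proof -
  have "((\<lambda>s. x + s *\<^sub>R v) has_derivative (\<lambda>s. s *\<^sub>R v)) (at t)"
    by (auto intro!: derivative_eq_intros)
  moreover have "(h has_derivative (\<lambda>u. g \<bullet> u)) (at (x + t *\<^sub>R v) within (\<lambda>s. x + s *\<^sub>R v) ` UNIV)"
    using x v by (intro has_derivative_subset[OF h]) auto
  ultimately have "((\<lambda>s. h (x + s *\<^sub>R v)) has_derivative (\<lambda>s. g \<bullet> (s *\<^sub>R v))) (at t)"
    by (rule has_derivative_in_compose)
  then show ?thesis
    by (simp add: has_field_derivative_def mult.commute[of _ "g \<bullet> v"] cong: if_cong)
qed

text \<open>The difference of two candidates lies in \<open>Rn d\<close> and is thus an admissible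
  direction; both give the same derivative along it, so its norm is 0.\<close>

lemma gradient_eqI:
  assumes g: "g \<in> Rn d" "(h has_derivative (\<lambda>v. g \<bullet> v)) (at x within Rn d)" and x: "x \<in> Rn d"
  shows "gradient d h x = g"
  unfolding gradient_def
proof (rule the_equality)
  fix g' assume g': "g' \<in> Rn d \<and> (h has_derivative (\<lambda>v. g' \<bullet> v)) (at x within Rn d)"
  let ?v = "g' - g"
  have "((\<lambda>s. h (x + s *\<^sub>R ?v)) has_real_derivative g \<bullet> ?v) (at 0)"
    by (rule has_real_derivative_line) (use g g' x in auto)
  moreover have "((\<lambda>s. h (x + s *\<^sub>R ?v)) has_real_derivative g' \<bullet> ?v) (at 0)"
    by (rule has_real_derivative_line) (use g g' x in auto)
  ultimately have "g \<bullet> ?v = g' \<bullet> ?v"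
    by (rule DERIV_unique)
  then have "?v \<bullet> ?v = 0"
    by (simp add: inner_diff_left)
  then show "g' = g"
    by simp
qed (use g in auto)

text \<open>Riesz representation: the coordinates of the gradient are the values of the derivative
  at the basis vectors. The vector represents the derivative on \<open>Rn d\<close>, and
  differentiability relative to \<open>Rn d\<close> tests nothing else.\<close>

lemma
  assumes h: "h differentiable (at x within Rn d)" and x: "x \<in> Rn d"
  shows gradient_in_Rn: "gradient d h x \<in> Rn d"
    and has_derivative_gradient: "(h has_derivative (\<lambda>v. gradient d h x \<bullet> v)) (at x within Rn d)"
proof -
  obtain D where D: "(h has_derivative D) (at x within Rn d)"
    using h by (auto simp: differentiable_def)
  interpret D: bounded_linear D
    using D by (rule has_derivative_bounded_linear)
  define g where "g = (\<Sum>j=1..d. D (basis_vec j) *\<^sub>R basis_vec j)"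
  have g: "g \<in> Rn d"
    by (auto simp: g_def)
  have D_eq: "D v = g \<bullet> v" if "v \<in> Rn d" for v
  proof -
    have "D v = D (Rn_proj d v)"
      using that by (simp add: Rn_proj_id)
    also have "\<dots> = g \<bullet> v"
      by (simp add: Rn_proj_def g_def D.sum D.scaleR inner_sum_left
          inner_commute[of "basis_vec _"] inner_basis_vec mult.commute)
    finally show ?thesis .
  qed
  have "((\<lambda>y. (h y - (h x + g \<bullet> (y - x))) / norm (y - x)) \<longlongrightarrow> 0) (at x within Rn d)
    \<longleftrightarrow> ((\<lambda>y. (h y - (h x + D (y - x))) / norm (y - x)) \<longlongrightarrow> 0) (at x within Rn d)"
    by (intro tendsto_cong) (use x in \<open>auto simp: eventually_at_filter D_eq\<close>)
  then have "(h has_derivative (\<lambda>v. g \<bullet> v)) (at x within Rn d)"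
    using D by (simp add: has_derivative_within bounded_linear_inner_right)
  with g show "gradient d h x \<in> Rn d"
    "(h has_derivative (\<lambda>v. gradient d h x \<bullet> v)) (at x within Rn d)"
    by (simp_all add: gradient_eqI[OF g _ x])
qed

text \<open>The smoothness part of \<open>standing_assumptions\<close> for a single function, so
  that the same lemmas serve each \<open>f i\<close> and their mean.\<close>

definition smooth_on_Rn :: "nat \<Rightarrow> real \<Rightarrow> (rvec \<Rightarrow> real) \<Rightarrow> bool"
  where "smooth_on_Rn d L h \<longleftrightarrow>
    (\<forall>x\<in>Rn d. h differentiable (at x within Rn d)) \<and>
    (\<forall>x\<in>Rn d. \<forall>y\<in>Rn d. norm (gradient d h x - gradient d h y) \<le> L * norm (x - y))"

lemma coord_coosge:
  "coord (coosge d \<mu> f x) j =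
    (if j \<in> {1..d} then (f (x + \<mu> *\<^sub>R basis_vec j) - f (x - \<mu> *\<^sub>R basis_vec j)) / (2 * \<mu>) else 0)"
  by (simp add: coosge_def coord_sum if_distrib[of "(*) _"] cong: if_cong)

lemma coosge_in_Rn: "coosge d \<mu> f x \<in> Rn d"
  by (auto simp: Rn_def coord_coosge)

context
  fixes d L h
  assumes h: "smooth_on_Rn d L h"
begin

lemma smooth_gradient_in_Rn: "x \<in> Rn d \<Longrightarrow> gradient d h x \<in> Rn d"
  using h by (auto simp: smooth_on_Rn_def intro: gradient_in_Rn)

lemma smooth_has_derivative:
  "x \<in> Rn d \<Longrightarrow> (h has_derivative (\<lambda>v. gradient d h x \<bullet> v)) (at x within Rn d)"
  using h by (auto simp: smooth_on_Rn_def intro: has_derivative_gradient)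

lemma smooth_gradient_lipschitz:
  "x \<in> Rn d \<Longrightarrow> y \<in> Rn d \<Longrightarrow> norm (gradient d h x - gradient d h y) \<le> L * norm (x - y)"
  using h by (auto simp: smooth_on_Rn_def)

lemma smooth_line_derivative:
  assumes "x \<in> Rn d" "v \<in> Rn d"
  shows "((\<lambda>s. h (x + s *\<^sub>R v)) has_real_derivative gradient d h (x + t *\<^sub>R v) \<bullet> v) (at t)"
  by (rule has_real_derivative_line) (use assms in \<open>auto intro: smooth_has_derivative\<close>)

text \<open>Along the segment the derivative deviates from its initial value by at most
  \<open>L * t * (norm v)\<^sup>2\<close>; integration over \<open>t\<close> gives the factor 1/2.
  The integration takes the form of monotonicity of \<open>?k\<close>, with a sign \<epsilon> for
  the two halves of the absolute value.\<close>

lemma smooth_taylor: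
  assumes x: "x \<in> Rn d" and v: "v \<in> Rn d"
  shows "\<bar>h (x + v) - h x - gradient d h x \<bullet> v\<bar> \<le> L / 2 * (norm v)\<^sup>2"
proof -
  let ?g = "gradient d h"
  have g: "\<bar>?g (x + t *\<^sub>R v) \<bullet> v - ?g x \<bullet> v\<bar> \<le> L * t * (norm v)\<^sup>2" if "0 \<le> t" for t
  proof -
    have "\<bar>(?g (x + t *\<^sub>R v) - ?g x) \<bullet> v\<bar> \<le> norm (?g (x + t *\<^sub>R v) - ?g x) * norm v"
      by (rule Cauchy_Schwarz_ineq2)
    also have "\<dots> \<le> (L * norm (x + t *\<^sub>R v - x)) * norm v"
      by (intro mult_right_mono smooth_gradient_lipschitz) (use x v in auto)
    finally show ?thesis
      using that by (simp add: inner_diff_left power2_eq_square)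
  qed
  have bound: "\<epsilon> * (h (x + v) - h x - ?g x \<bullet> v) \<le> L / 2 * (norm v)\<^sup>2" if \<epsilon>: "\<bar>\<epsilon>\<bar> = 1" for \<epsilon>
  proof -
    let ?k = "\<lambda>t. \<epsilon> * (h (x + t *\<^sub>R v) - t * (?g x \<bullet> v)) - L / 2 * t\<^sup>2 * (norm v)\<^sup>2"
    have "?k 1 \<le> ?k 0"
    proof (rule DERIV_nonpos_imp_nonincreasing[where f = ?k])
      fix t :: real assume t: "0 \<le> t" "t \<le> 1"
      have "(?k has_real_derivative
          \<epsilon> * (?g (x + t *\<^sub>R v) \<bullet> v - ?g x \<bullet> v) - L * t * (norm v)\<^sup>2) (at t)"
        by (auto intro!: derivative_eq_intros smooth_line_derivative x v)
      moreover have "\<epsilon> * (?g (x + t *\<^sub>R v) \<bullet> v - ?g x \<bullet> v) \<le> L * t * (norm v)\<^sup>2"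
        using g[OF t(1)] \<epsilon> by (metis abs_ge_self abs_mult mult_1 order_trans)
      ultimately show "\<exists>y. (?k has_real_derivative y) (at t) \<and> y \<le> 0"
        by (intro exI[of _ "\<epsilon> * (?g (x + t *\<^sub>R v) \<bullet> v - ?g x \<bullet> v) - L * t * (norm v)\<^sup>2"]) simp
    qed simp
    then show ?thesis
      by (simp add: algebra_simps)
  qed
  show ?thesis
    using bound[of 1] bound[of "-1"] by (intro abs_leI) simp_all
qed

text \<open>In a central difference the values of \<open>h\<close> at \<open>x\<close> cancel and
  the two Taylor remainders add up to at most \<open>L * \<mu>\<^sup>2\<close>; division by
  \<open>2 * \<mu>\<close> leaves \<open>L * \<mu> / 2\<close> per coordinate.\<close>

lemma coosge_error:
  assumes x: "x \<in> Rn d" and \<mu>: "0 < \<mu>"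
  shows "(norm (coosge d \<mu> h x - gradient d h x))\<^sup>2 \<le> L\<^sup>2 * real d * \<mu>\<^sup>2 / 4"
proof -
  have "\<bar>coord (coosge d \<mu> h x - gradient d h x) j\<bar> \<le> L * \<mu> / 2" if j: "j \<in> {1..d}" for j
  proof -
    let ?g = "coord (gradient d h x) j"
    let ?D = "h (x + \<mu> *\<^sub>R basis_vec j) - h (x - \<mu> *\<^sub>R basis_vec j)"
    have "\<bar>h (x + c *\<^sub>R basis_vec j) - h x - c * ?g\<bar> \<le> L / 2 * c\<^sup>2" for c
      using smooth_taylor[OF x, of "c *\<^sub>R basis_vec j"] j by (simp add: inner_basis_vec)
    from this[of \<mu>] this[of "- \<mu>"]
    have "\<bar>h (x + \<mu> *\<^sub>R basis_vec j) - h x - \<mu> * ?g\<bar> \<le> L / 2 * \<mu>\<^sup>2"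
      "\<bar>h (x - \<mu> *\<^sub>R basis_vec j) - h x + \<mu> * ?g\<bar> \<le> L / 2 * \<mu>\<^sup>2"
      by simp_all
    then have "\<bar>?D - 2 * \<mu> * ?g\<bar> \<le> L * \<mu>\<^sup>2"
      by linarith
    moreover have "?D / (2 * \<mu>) - ?g = (?D - 2 * \<mu> * ?g) / (2 * \<mu>)"
      using \<mu> by (simp add: diff_divide_distrib)
    ultimately have "\<bar>?D / (2 * \<mu>) - ?g\<bar> \<le> L * \<mu>\<^sup>2 / (2 * \<mu>)"
      using \<mu> by (simp add: divide_right_mono)
    also have "\<dots> = L * \<mu> / 2"
      using \<mu> by (simp add: power2_eq_square)
    finally show ?thesis
      using j by (simp add: coord_coosge)
  qed
  then have "(norm (coosge d \<mu> h x - gradient d h x))\<^sup>2 \<le> real d * (L * \<mu> / 2)\<^sup>2"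
    by (intro norm2_Rn_le) (use x in \<open>auto intro: coosge_in_Rn smooth_gradient_in_Rn\<close>)
  then show ?thesis
    by (simp add: power_divide power_mult_distrib mult_ac)
qed

text \<open>A coordinate of the difference is a difference quotient of \<open>?k\<close>, the gap
  between \<open>h\<close> on two parallel lines. The derivative of \<open>?k\<close> is at most
  \<open>L * norm (x - z)\<close>, so the mean value theorem gives a constant free of \<mu>.\<close>

lemma coosge_lipschitz:
  assumes x: "x \<in> Rn d" and z: "z \<in> Rn d" and \<mu>: "0 < \<mu>"
  shows "(norm (coosge d \<mu> h x - coosge d \<mu> h z))\<^sup>2 \<le> L\<^sup>2 * real d * (norm (x - z))\<^sup>2"
proof -
  have "\<bar>coord (coosge d \<mu> h x - coosge d \<mu> h z) j\<bar> \<le> L * norm (x - z)" if j: "j \<in> {1..d}" for j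
  proof -
    let ?e = "basis_vec j"
    let ?k = "\<lambda>s. h (x + s *\<^sub>R ?e) - h (z + s *\<^sub>R ?e)"
    let ?k' = "\<lambda>s. gradient d h (x + s *\<^sub>R ?e) \<bullet> ?e - gradient d h (z + s *\<^sub>R ?e) \<bullet> ?e"
    have "norm (?k \<mu> - ?k (- \<mu>)) \<le> L * norm (x - z) * norm (\<mu> - - \<mu>)"
    proof (rule field_differentiable_bound[OF convex_UNIV])
      fix s :: real
      show "(?k has_real_derivative ?k' s) (at s)"
        by (intro DERIV_diff smooth_line_derivative) (use x z j in auto)
      have "\<bar>?k' s\<bar> \<le> norm (gradient d h (x + s *\<^sub>R ?e) - gradient d h (z + s *\<^sub>R ?e)) * norm ?e"
        unfolding inner_diff_left[symmetric] by (rule Cauchy_Schwarz_ineq2)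
      also have "\<dots> \<le> L * norm ((x + s *\<^sub>R ?e) - (z + s *\<^sub>R ?e)) * norm ?e"
        by (intro mult_right_mono smooth_gradient_lipschitz) (use x z j in auto)
      finally show "norm (?k' s) \<le> L * norm (x - z)"
        by simp
    qed auto
    then have "\<bar>(?k \<mu> - ?k (- \<mu>)) / (2 * \<mu>)\<bar> \<le> L * norm (x - z)"
      using \<mu> by (simp add: divide_le_eq)
    then show ?thesis
      using j by (simp add: coord_coosge diff_divide_distrib)
  qed
  then have "(norm (coosge d \<mu> h x - coosge d \<mu> h z))\<^sup>2 \<le> real d * (L * norm (x - z))\<^sup>2"
    by (intro norm2_Rn_le) (auto intro: coosge_in_Rn)
  then show ?thesis
    by (simp add: power_mult_distrib mult_ac)
qed

end

section \<open>From the summands to their mean\<close>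

lemma gradient_mean:
  assumes "\<And>i. i \<in> {1..n} \<Longrightarrow> smooth_on_Rn d L (f i)" and x: "x \<in> Rn d"
  shows "gradient d (mean n f) x = (1 / real n) *\<^sub>R (\<Sum>i=1..n. gradient d (f i) x)"
    and differentiable_mean: "mean n f differentiable (at x within Rn d)"
proof -
  let ?g = "(1 / real n) *\<^sub>R (\<Sum>i=1..n. gradient d (f i) x)"
  have "((\<lambda>x. (\<Sum>i=1..n. f i x) / real n) has_derivative
      (\<lambda>v. (\<Sum>i=1..n. gradient d (f i) x \<bullet> v) / real n)) (at x within Rn d)"
    by (simp only: divide_inverse)
       (intro has_derivative_mult_left has_derivative_sum smooth_has_derivative[where L=L] assms)
  then have *: "(mean n f has_derivative (\<lambda>v. ?g \<bullet> v)) (at x within Rn d)"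
    by (simp add: mean_def[abs_def] inner_sum_left)
  then show "mean n f differentiable (at x within Rn d)"
    by (auto simp: differentiable_def)
  have "?g \<in> Rn d"
    by (intro Rn_closed smooth_gradient_in_Rn[where L=L] assms)
  then show "gradient d (mean n f) x = ?g"
    using * x by (rule gradient_eqI)
qed

lemma smooth_on_Rn_mean:
  assumes "1 \<le> n" and f: "\<And>i. i \<in> {1..n} \<Longrightarrow> smooth_on_Rn d L (f i)"
  shows "smooth_on_Rn d L (mean n f)"
  unfolding smooth_on_Rn_def
proof (intro conjI ballI)
  fix x assume x: "x \<in> Rn d"
  show "mean n f differentiable at x within Rn d"
    using f x by (rule differentiable_mean)
  fix y assume y: "y \<in> Rn d"
  have "gradient d (mean n f) x - gradient d (mean n f) y
      = (1 / real n) *\<^sub>R (\<Sum>i=1..n. gradient d (f i) x - gradient d (f i) y)"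
    by (subst (1 2) gradient_mean[where L=L]) (auto simp: f x y sum_subtractf scaleR_diff_right)
  also have "norm \<dots> \<le> (1 / real n) * (\<Sum>i=1..n. L * norm (x - y))"
    unfolding norm_scaleR using assms(1)
    by (intro mult_mono order_trans[OF norm_sum] sum_mono smooth_gradient_lipschitz f x y) auto
  also have "\<dots> = L * norm (x - y)"
    using assms(1) by simp
  finally show "norm (gradient d (mean n f) x - gradient d (mean n f) y) \<le> L * norm (x - y)" .
qed

text \<open>By linearity, the conditional mean of the search direction is the coordinate estimator
  of \<open>mean n f\<close>, so \<open>coosge_error\<close> covers its bias.\<close>

lemma coosge_mean:
  "coosge d \<mu> (mean n f) x = (1 / real n) *\<^sub>R (\<Sum>i=1..n. coosge d \<mu> (f i) x)"
  by (rule rvec_eqI)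
     (auto simp: coord_coosge coord_sum mean_def sum_subtractf diff_divide_distrib mult.commute
       simp flip: sum_divide_distrib)

subsection \<open>Expectations over mini-batches\<close>

lemma expectation_cong_set_pmf:
  fixes g h :: "'a \<Rightarrow> real"
  assumes "\<And>x. x \<in> set_pmf p \<Longrightarrow> g x = h x"
  shows "measure_pmf.expectation p g = measure_pmf.expectation p h"
  by (rule integral_cong_AE) (use assms in \<open>auto simp: AE_measure_pmf_iff\<close>)

lemma expectation_mono_set_pmf:
  fixes g h :: "'a \<Rightarrow> real"
  assumes "finite (set_pmf p)" "\<And>x. x \<in> set_pmf p \<Longrightarrow> g x \<le> h x"
  shows "measure_pmf.expectation p g \<le> measure_pmf.expectation p h"
  by (rule integral_mono_AE)
     (use assms in \<open>auto simp: AE_measure_pmf_iff integrable_measure_pmf_finite\<close>)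

lemma expectation_bind_pmf_finite:
  fixes h :: "'b \<Rightarrow> real"
  assumes "finite (set_pmf p)" "\<And>x. x \<in> set_pmf p \<Longrightarrow> finite (set_pmf (q x))"
  shows "measure_pmf.expectation (bind_pmf p q) h
    = measure_pmf.expectation p (\<lambda>x. measure_pmf.expectation (q x) h)"
  using assms
  by (subst pmf_expectation_bind[of "set_pmf p"])
     (auto simp: integral_measure_pmf[of "set_pmf p"])

lemma finite_set_replicate_pmf: "finite (set_pmf p) \<Longrightarrow> finite (set_pmf (replicate_pmf n p))"
  using finite_lists_length_eq[of "set_pmf p" n]
  by (simp add: set_replicate_pmf lists_eq_set)

lemma expectation_replicate_pmf_Suc:
  fixes h :: "'a list \<Rightarrow> real"
  assumes "finite (set_pmf p)"
  shows "measure_pmf.expectation (replicate_pmf (Suc n) p) h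
    = measure_pmf.expectation p (\<lambda>x. measure_pmf.expectation (replicate_pmf n p) (\<lambda>xs. h (x # xs)))"
  by (simp add: expectation_bind_pmf_finite finite_set_replicate_pmf assms)

text \<open>Conditioning on the past: entry \<open>t\<close> is independent of the entries before
  it, so it may be averaged out with those held fixed.\<close>

lemma expectation_replicate_pmf_nth:
  fixes h :: "'a list \<Rightarrow> 'a \<Rightarrow> real"
  assumes fin: "finite (set_pmf p)" and "t < T"
  shows "measure_pmf.expectation (replicate_pmf T p) (\<lambda>xs. h (take t xs) (xs ! t))
    = measure_pmf.expectation (replicate_pmf T p)
        (\<lambda>xs. measure_pmf.expectation p (h (take t xs)))"
proof -
  obtain k where T: "T = t + Suc k"
    using \<open>t < T\<close> less_iff_Suc_add by auto
  note fins = finite_set_replicate_pmf[OF fin]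
  \<comment> \<open>The list splits into past, entry \<open>t\<close> and future; an integrand that
    reads only the first two is constant in the future.\<close>
  have split: "measure_pmf.expectation (replicate_pmf T p) g
      = measure_pmf.expectation (replicate_pmf t p) (\<lambda>xs. measure_pmf.expectation p (\<lambda>x.
          measure_pmf.expectation (replicate_pmf k p) (\<lambda>ys. g (xs @ x # ys))))"
    for g :: "'a list \<Rightarrow> real"
    unfolding T replicate_pmf_distrib
    by (subst expectation_bind_pmf_finite)
       (auto simp: expectation_bind_pmf_finite fins fin simp del: replicate_pmf.simps
         intro!: expectation_cong_set_pmf
         simp: expectation_replicate_pmf_Suc)
  show ?thesis
    unfolding split
    by (rule expectation_cong_set_pmf) (auto simp: set_replicate_pmf)
qed

text \<open>The cross terms vanish: the inner product of a fixed vector with a centred draw has mean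
  0. The offset \<open>a\<close> is arbitrary so that the induction can absorb the first draw into
  it.\<close>

lemma expectation_norm2_sum_list:
  fixes W :: "'a \<Rightarrow> 'b::real_inner"
  assumes A: "finite A" "A \<noteq> {}" and W: "(\<Sum>i\<in>A. W i) = 0"
  shows "measure_pmf.expectation (replicate_pmf b (pmf_of_set A))
      (\<lambda>is. (norm (a + (\<Sum>i\<leftarrow>is. W i)))\<^sup>2)
    = (norm a)\<^sup>2 + real b * ((\<Sum>i\<in>A. (norm (W i))\<^sup>2) / real (card A))"
proof (induction b arbitrary: a)
  case (Suc b)
  let ?S = "\<Sum>i\<in>A. (norm (W i))\<^sup>2"
  have c: "real (card A) \<noteq> 0"
    using A by simp
  have "measure_pmf.expectation (replicate_pmf (Suc b) (pmf_of_set A))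
      (\<lambda>is. (norm (a + (\<Sum>i\<leftarrow>is. W i)))\<^sup>2)
    = measure_pmf.expectation (pmf_of_set A) (\<lambda>i. measure_pmf.expectation
        (replicate_pmf b (pmf_of_set A)) (\<lambda>is. (norm ((a + W i) + (\<Sum>i\<leftarrow>is. W i)))\<^sup>2))"
    using A by (simp add: expectation_replicate_pmf_Suc add.assoc del: replicate_pmf.simps)
  also have "\<dots> = (\<Sum>i\<in>A. (norm (a + W i))\<^sup>2 + real b * (?S / real (card A))) / real (card A)"
    using A by (simp add: Suc integral_pmf_of_set)
  also have "(\<Sum>i\<in>A. (norm (a + W i))\<^sup>2 + real b * (?S / real (card A)))
      = real (card A) * (norm a)\<^sup>2 + 2 * (a \<bullet> (\<Sum>i\<in>A. W i)) + ?S + real b * ?S"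
    using c by (simp add: power2_norm_eq_inner inner_add_left inner_add_right sum.distrib
        inner_sum_right inner_commute sum_distrib_left algebra_simps flip: sum_distrib_left)
  finally show ?case
    using c by (simp add: W field_simps)
qed simp

text \<open>Each of the \<open>b\<close> independent draws misses \<open>i\<close> with probability
  \<open>1 - 1 / real (card A)\<close>. For \<open>A = {1..n}\<close> the value is
  \<open>1 - p\<close>.\<close>

lemma expectation_notin_replicate_pmf:
  assumes A: "finite A" "A \<noteq> {}" and i: "i \<in> A"
  shows "measure_pmf.expectation (replicate_pmf b (pmf_of_set A))
      (\<lambda>is. if i \<in> set is then 0 else 1 :: real) = (1 - 1 / real (card A)) ^ b"
proof (induction b)
  case (Suc b)
  let ?q = "(1 - 1 / real (card A)) ^ b"
  have "measure_pmf.expectation (replicate_pmf (Suc b) (pmf_of_set A))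
      (\<lambda>is. if i \<in> set is then 0 else 1 :: real)
    = measure_pmf.expectation (pmf_of_set A) (\<lambda>j. if j = i then 0 else
        measure_pmf.expectation (replicate_pmf b (pmf_of_set A)) (\<lambda>is. if i \<in> set is then 0 else 1 :: real))"
  proof (subst expectation_replicate_pmf_Suc)
    show "finite (set_pmf (pmf_of_set A))"
      using A by simp
  qed (rule expectation_cong_set_pmf, case_tac "x = i", auto)
  also have "\<dots> = (\<Sum>j\<in>A. if j = i then 0 else ?q) / real (card A)"
    unfolding Suc using A by (simp add: integral_pmf_of_set)
  also have "(\<Sum>j\<in>A. if j = i then 0 else ?q) = (\<Sum>j\<in>A - {i}. ?q)"
    using A i by (subst sum.remove[of A i]) auto
  also have "\<dots> = (real (card A) - 1) * ?q"
    using A i by (simp add: card_Diff_singleton of_nat_diff card_gt_0_iff Suc_leI)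
  finally show ?case
    using A by (simp add: field_simps)
qed simp

text \<open>Bias-variance decomposition; the variance of one summand is bounded by its second moment.\<close>
lemma expectation_norm2_minibatch_mean_le:
  fixes Y :: "'a \<Rightarrow> 'b::real_inner"
  assumes A: "finite A" "A \<noteq> {}" and b: "0 < b"
    and m: "m = (1 / real (card A)) *\<^sub>R (\<Sum>i\<in>A. Y i)"
  shows "measure_pmf.expectation (replicate_pmf b (pmf_of_set A))
      (\<lambda>is. (norm ((1 / real b) *\<^sub>R (\<Sum>i\<leftarrow>is. Y i) + u))\<^sup>2)
    \<le> (norm (m + u))\<^sup>2 + (\<Sum>i\<in>A. (norm (Y i))\<^sup>2) / (real b * real (card A))"
proof -
  let ?D = "replicate_pmf b (pmf_of_set A)"
  let ?W = "\<lambda>i. Y i - m"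
  have c: "0 < real (card A)"
    using A by (simp add: card_gt_0_iff)
  have sumY: "(\<Sum>i\<in>A. Y i) = real (card A) *\<^sub>R m"
    using c by (simp add: m)
  have eq: "(norm ((1 / real b) *\<^sub>R (\<Sum>i\<leftarrow>is. Y i) + u))\<^sup>2
      = (1 / real b)\<^sup>2 * (norm (real b *\<^sub>R (m + u) + (\<Sum>i\<leftarrow>is. ?W i)))\<^sup>2"
    if "is \<in> set_pmf ?D" for "is"
  proof -
    have "length is = b"
      using that by (simp add: set_replicate_pmf)
    then have sum: "(\<Sum>i\<leftarrow>is. Y i) = (\<Sum>i\<leftarrow>is. ?W i) + real b *\<^sub>R m"
      by (induction "is" arbitrary: b) (auto simp: algebra_simps)
    then have "(1 / real b) *\<^sub>R (\<Sum>i\<leftarrow>is. Y i) + u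
        = (1 / real b) *\<^sub>R (real b *\<^sub>R (m + u) + (\<Sum>i\<leftarrow>is. ?W i))"
      unfolding sum scaleR_add_right using b by simp
    then show ?thesis
      by (simp add: power_divide)
  qed
  have "measure_pmf.expectation ?D (\<lambda>is. (norm ((1 / real b) *\<^sub>R (\<Sum>i\<leftarrow>is. Y i) + u))\<^sup>2)
      = (1 / real b)\<^sup>2 * measure_pmf.expectation ?D
          (\<lambda>is. (norm (real b *\<^sub>R (m + u) + (\<Sum>i\<leftarrow>is. ?W i)))\<^sup>2)"
    by (subst expectation_cong_set_pmf[OF eq]) simp_all
  also have "\<dots> = (1 / real b)\<^sup>2 * ((norm (real b *\<^sub>R (m + u)))\<^sup>2
      + real b * ((\<Sum>i\<in>A. (norm (?W i))\<^sup>2) / real (card A)))"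
    by (subst expectation_norm2_sum_list[OF A]) (simp_all add: sum_subtractf sumY sum_constant_scaleR)
  also have "\<dots> = (norm (m + u))\<^sup>2 + (\<Sum>i\<in>A. (norm (?W i))\<^sup>2) / (real b * real (card A))"
    unfolding norm_scaleR using b c
    by (simp add: power_mult_distrib field_simps power2_eq_square)
  also have "(\<Sum>i\<in>A. (norm (?W i))\<^sup>2)
      = (\<Sum>i\<in>A. (norm (Y i))\<^sup>2) - 2 * ((\<Sum>i\<in>A. Y i) \<bullet> m) + real (card A) * (m \<bullet> m)"
    by (simp add: power2_norm_eq_inner inner_diff_left inner_diff_right sum.distrib
        sum_subtractf inner_sum_left inner_sum_right inner_commute sum_distrib_left algebra_simps
        flip: sum_distrib_left)
  also have "\<dots> \<le> (\<Sum>i\<in>A. (norm (Y i))\<^sup>2)"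
    by (simp add: sumY)
  finally show ?thesis
    using b c by (simp add: divide_right_mono)
qed

subsection \<open>One iteration\<close>

text \<open>Completing the square turns the distance to \<open>x - \<eta> *\<^sub>R v\<close> into
  the distance to \<open>x\<close> plus a linear term; the remaining
  \<open>\<eta> / 2 * (norm v)\<^sup>2\<close> is the same for all points and cancels.\<close>

lemma prox_step_inequality:
  assumes \<psi>: "convex_on (Rn d) \<psi>" and \<eta>: "0 < \<eta>" and x: "x \<in> Rn d" and v: "v \<in> Rn d"
    and z: "z \<in> Rn d" and y: "y = prox d \<eta> \<psi> (x - \<eta> *\<^sub>R v)"
  shows "\<psi> y + (y - x) \<bullet> v + 1 / (2 * \<eta>) * (norm (y - x))\<^sup>2 + 1 / (2 * \<eta>) * (norm (z - y))\<^sup>2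
    \<le> \<psi> z + (z - x) \<bullet> v + 1 / (2 * \<eta>) * (norm (z - x))\<^sup>2"
proof -
  have "1 / (2 * \<eta>) * (norm (w - (x - \<eta> *\<^sub>R v)))\<^sup>2
      = 1 / (2 * \<eta>) * (norm (w - x))\<^sup>2 + (w - x) \<bullet> v + \<eta> / 2 * (norm v)\<^sup>2" for w
  proof -
    have "w - (x - \<eta> *\<^sub>R v) = (w - x) + \<eta> *\<^sub>R v"
      by simp
    also have "(norm \<dots>)\<^sup>2 = (norm (w - x))\<^sup>2 + 2 * \<eta> * ((w - x) \<bullet> v) + \<eta>\<^sup>2 * (norm v)\<^sup>2"
      by (simp add: power2_norm_eq_inner inner_add_left inner_add_right inner_commute algebra_simps)
        (simp add: power2_eq_square)
    finally show ?thesis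
      using \<eta> by (simp add: field_simps power2_eq_square)
  qed
  then show ?thesis
    using prox_three_point[OF \<psi> \<eta> _ z y] x v by simp
qed

text \<open>Sum of four inequalities: the exact step \<open>y\<close> against \<open>x\<close>, the
  actual step \<open>x'\<close> against \<open>y\<close>, smoothness from \<open>x\<close> to
  \<open>x'\<close>, and Young's inequality for the direction error. The squared distance of
  \<open>x'\<close> and \<open>y\<close> gained in the second is spent in the fourth.\<close>

lemma objective_prox_step_le:
  fixes d n f \<psi> \<eta> x v
  defines "x' \<equiv> prox d \<eta> \<psi> (x - \<eta> *\<^sub>R v)"
  assumes \<psi>: "convex_on (Rn d) \<psi>" and f: "smooth_on_Rn d L (mean n f)"
    and \<eta>: "0 < \<eta>" and x: "x \<in> Rn d" and v: "v \<in> Rn d"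
  shows "objective n f \<psi> x' \<le> objective n f \<psi> x - \<eta> / 2 * (norm (gradient_mapping d n f \<psi> \<eta> x))\<^sup>2
    - (1 / (2 * \<eta>) - L / 2) * (norm (x' - x))\<^sup>2
    + \<eta> / 2 * (norm (v - gradient d (mean n f) x))\<^sup>2"
proof -
  let ?g = "gradient d (mean n f) x"
  let ?q = "1 / (2 * \<eta>)"
  define y where "y = prox d \<eta> \<psi> (x - \<eta> *\<^sub>R ?g)"
  have g: "?g \<in> Rn d"
    using smooth_gradient_in_Rn[OF f x] .
  have x': "x' \<in> Rn d"
    unfolding x'_def by (rule prox_in_Rn[OF \<psi> \<eta>]) (use x v in auto)
  have y: "y \<in> Rn d"
    unfolding y_def by (rule prox_in_Rn[OF \<psi> \<eta>]) (use x g in auto)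
  have 1: "\<psi> y + (y - x) \<bullet> ?g + ?q * (norm (y - x))\<^sup>2 + ?q * (norm (y - x))\<^sup>2 \<le> \<psi> x"
    using prox_step_inequality[OF \<psi> \<eta> x g x y_def] by (simp add: norm_minus_commute)
  have 2: "\<psi> x' + (x' - x) \<bullet> v + ?q * (norm (x' - x))\<^sup>2 + ?q * (norm (x' - y))\<^sup>2
      \<le> \<psi> y + (y - x) \<bullet> v + ?q * (norm (y - x))\<^sup>2"
    using prox_step_inequality[OF \<psi> \<eta> x v y x'_def[THEN meta_eq_to_obj_eq]]
    by (simp add: norm_minus_commute)
  have 3: "mean n f x' \<le> mean n f x + (x' - x) \<bullet> ?g + L / 2 * (norm (x' - x))\<^sup>2"
    using order_trans[OF abs_ge_self smooth_taylor[OF f x, of "x' - x"]] x x'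
    by (simp add: inner_commute)
  have 4: "(x' - x) \<bullet> ?g - (x' - x) \<bullet> v + (y - x) \<bullet> v - (y - x) \<bullet> ?g
      \<le> ?q * (norm (x' - y))\<^sup>2 + \<eta> / 2 * (norm (v - ?g))\<^sup>2"
  proof -
    have "0 \<le> (norm ((x' - y) + \<eta> *\<^sub>R (v - ?g)))\<^sup>2"
      by simp
    also have "\<dots> = (norm (x' - y))\<^sup>2 + 2 * \<eta> * ((x' - y) \<bullet> (v - ?g)) + \<eta>\<^sup>2 * (norm (v - ?g))\<^sup>2"
      unfolding power2_norm_eq_inner
      by (simp only: inner_add_left inner_add_right inner_scaleR_left inner_scaleR_right
          inner_commute power2_eq_square)
    also have "\<dots> = 2 * \<eta> * (?q * (norm (x' - y))\<^sup>2 + (x' - y) \<bullet> (v - ?g) + \<eta> / 2 * (norm (v - ?g))\<^sup>2)"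
      using \<eta> by (simp add: field_simps power2_eq_square)
    finally have "0 \<le> ?q * (norm (x' - y))\<^sup>2 + (x' - y) \<bullet> (v - ?g) + \<eta> / 2 * (norm (v - ?g))\<^sup>2"
      using \<eta> by (simp add: zero_le_mult_iff)
    then show ?thesis
      by (simp add: inner_diff_left inner_diff_right)
  qed
  \<comment> \<open>Of the two equal quadratic terms in \<open>1\<close>, one cancels against
    \<open>2\<close> and the other is the gradient mapping term.\<close>
  have "norm (gradient_mapping d n f \<psi> \<eta> x) = norm (y - x) / \<eta>"
    using \<eta> by (simp add: gradient_mapping_def y_def norm_minus_commute)
  then have "\<eta> / 2 * (norm (gradient_mapping d n f \<psi> \<eta> x))\<^sup>2 = ?q * (norm (y - x))\<^sup>2"
    using \<eta> by (simp add: power_divide power2_eq_square)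
  with 1 2 3 4 show ?thesis
    unfolding objective_def left_diff_distrib by linarith
qed

lemma norm2_add_le:
  fixes u v :: "'a::real_inner"
  assumes "0 < \<beta>"
  shows "(norm (u + v))\<^sup>2 \<le> (1 + 1 / \<beta>) * (norm u)\<^sup>2 + (1 + \<beta>) * (norm v)\<^sup>2"
proof -
  have "0 \<le> (norm (u - \<beta> *\<^sub>R v))\<^sup>2 / \<beta>"
    using assms by simp
  also have "\<dots> = (norm u)\<^sup>2 / \<beta> - 2 * (u \<bullet> v) + \<beta> * (norm v)\<^sup>2"
    using assms unfolding power2_norm_eq_inner
    by (simp add: inner_diff_left inner_diff_right inner_commute field_simps)
  finally show ?thesis
    by (simp add: power2_norm_eq_inner inner_add_left inner_add_right inner_commute algebra_simps)
qed

text \<open>One iteration with the mini-batch as an argument, so that it can be averaged over while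
  the state is fixed.\<close>

definition zo_step ::
  "nat \<Rightarrow> nat \<Rightarrow> nat \<Rightarrow> (nat \<Rightarrow> rvec \<Rightarrow> real) \<Rightarrow> (rvec \<Rightarrow> real) \<Rightarrow> real \<Rightarrow> real \<Rightarrow>
    rvec \<times> (nat \<Rightarrow> rvec) \<Rightarrow> nat list \<Rightarrow> rvec \<times> (nat \<Rightarrow> rvec)"
  where "zo_step d n b f \<psi> \<mu> \<eta> = (\<lambda>(x, z) B.
    (prox d \<eta> \<psi> (x - \<eta> *\<^sub>R ((1 / real b) *\<^sub>R (\<Sum>i\<leftarrow>B. coosge d \<mu> (f i) x - coosge d \<mu> (f i) (z i))
        + (1 / real n) *\<^sub>R (\<Sum>i=1..n. coosge d \<mu> (f i) (z i)))),
     \<lambda>i. if i \<in> set B then x else z i))"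

lemma zo_proxsaga_Suc:
  "zo_proxsaga d n b f \<psi> \<mu> \<eta> x0 Is (Suc t)
    = zo_step d n b f \<psi> \<mu> \<eta> (zo_proxsaga d n b f \<psi> \<mu> \<eta> x0 Is t) (Is ! t)"
  by (simp add: zo_step_def Let_def split_beta)

text \<open>The state is adapted to the past: batches from \<open>s\<close> on cannot influence it.
  This brings expectations into the form of \<open>expectation_replicate_pmf_nth\<close>.\<close>

lemma zo_proxsaga_take:
  "t \<le> s \<Longrightarrow> zo_proxsaga d n b f \<psi> \<mu> \<eta> x0 (take s Is) t = zo_proxsaga d n b f \<psi> \<mu> \<eta> x0 Is t"
  by (induction t) (simp_all add: zo_proxsaga_Suc del: zo_proxsaga.simps(2))

definition lyapunov ::
  "nat \<Rightarrow> (nat \<Rightarrow> rvec \<Rightarrow> real) \<Rightarrow> (rvec \<Rightarrow> real) \<Rightarrow> real \<Rightarrow> rvec \<times> (nat \<Rightarrow> rvec) \<Rightarrow> real"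
  where "lyapunov n f \<psi> c = (\<lambda>(x, z).
    objective n f \<psi> x + c * ((\<Sum>i=1..n. (norm (x - z i))\<^sup>2) / real n))"

section \<open>The state recursion and the expected descent of the Lyapunov function\<close>

locale zo_saga =
  fixes d n b :: nat and f :: "nat \<Rightarrow> rvec \<Rightarrow> real" and \<psi> :: "rvec \<Rightarrow> real" and L \<mu> \<eta> :: real
  assumes n: "1 \<le> n" and b: "1 \<le> b" and \<mu>: "0 < \<mu>" and \<eta>: "0 < \<eta>"
    and \<psi>: "convex_on (Rn d) \<psi>"
    and f: "\<And>i. i \<in> {1..n} \<Longrightarrow> smooth_on_Rn d L (f i)"
begin

abbreviation "batch \<equiv> replicate_pmf b (pmf_of_set {1..n})"
abbreviation "step \<equiv> zo_step d n b f \<psi> \<mu> \<eta>"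
abbreviation "state \<equiv> zo_proxsaga d n b f \<psi> \<mu> \<eta>"
abbreviation "F \<equiv> objective n f \<psi>"
abbreviation "G \<equiv> gradient_mapping d n f \<psi> \<eta>"
abbreviation "dist2 x z \<equiv> (\<Sum>i=1..n. (norm (x - z i :: rvec))\<^sup>2) / real n"

lemma finite_set_batch: "finite (set_pmf batch)"
  using n by (intro finite_set_replicate_pmf) simp

lemma smooth_mean: "smooth_on_Rn d L (mean n f)"
  using n f by (rule smooth_on_Rn_mean)

lemma estimator_in_Rn:
  "(1 / real b) *\<^sub>R (\<Sum>i\<leftarrow>B. coosge d \<mu> (f i) x - coosge d \<mu> (f i) (z i))
    + (1 / real n) *\<^sub>R (\<Sum>i=1..n. coosge d \<mu> (f i) (z i)) \<in> Rn d"
proof -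
  have "(\<Sum>i\<leftarrow>B. coosge d \<mu> (f i) x - coosge d \<mu> (f i) (z i)) \<in> Rn d"
    by (induction B) (auto intro: coosge_in_Rn)
  then show ?thesis
    by (auto intro: coosge_in_Rn)
qed

lemma step_in_Rn:
  assumes "x \<in> Rn d" "\<And>i. z i \<in> Rn d"
  shows "fst (step (x, z) B) \<in> Rn d" "snd (step (x, z) B) i \<in> Rn d"
  using assms estimator_in_Rn
  by (auto simp: zo_step_def intro!: prox_in_Rn[OF \<psi> \<eta>])

lemma state_in_Rn:
  assumes "x0 \<in> Rn d"
  shows "fst (state x0 Is t) \<in> Rn d \<and> (\<forall>i. snd (state x0 Is t) i \<in> Rn d)"
proof (induction t)
  case (Suc t)
  obtain x z where "state x0 Is t = (x, z)"
    by fastforce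
  then show ?case
    using Suc step_in_Rn unfolding zo_proxsaga_Suc by auto
qed (use assms in simp)

text \<open>The error is a batch mean of \<open>?Y i\<close> plus the fixed vector
  \<open>?u\<close>. Its expectation is the bias of the estimator for the mean;
  \<open>coosge_lipschitz\<close> bounds the second moments of \<open>?Y i\<close>.\<close>

lemma expectation_estimator_error:
  assumes x: "x \<in> Rn d" and z: "\<And>i. z i \<in> Rn d"
  shows "measure_pmf.expectation batch (\<lambda>B.
      (norm ((1 / real b) *\<^sub>R (\<Sum>i\<leftarrow>B. coosge d \<mu> (f i) x - coosge d \<mu> (f i) (z i))
        + (1 / real n) *\<^sub>R (\<Sum>i=1..n. coosge d \<mu> (f i) (z i)) - gradient d (mean n f) x))\<^sup>2)
    \<le> L\<^sup>2 * real d * \<mu>\<^sup>2 / 4 + L\<^sup>2 * real d / real b * dist2 x z"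
proof -
  let ?Y = "\<lambda>i. coosge d \<mu> (f i) x - coosge d \<mu> (f i) (z i)"
  let ?m = "(1 / real (card {1..n})) *\<^sub>R (\<Sum>i=1..n. ?Y i)"
  let ?u = "(1 / real n) *\<^sub>R (\<Sum>i=1..n. coosge d \<mu> (f i) (z i)) - gradient d (mean n f) x"
  have "measure_pmf.expectation batch (\<lambda>B. (norm ((1 / real b) *\<^sub>R (\<Sum>i\<leftarrow>B. ?Y i) + ?u))\<^sup>2)
      \<le> (norm (?m + ?u))\<^sup>2 + (\<Sum>i=1..n. (norm (?Y i))\<^sup>2) / (real b * real (card {1..n}))"
    by (rule expectation_norm2_minibatch_mean_le) (use n b in auto)
  also have "?m + ?u = coosge d \<mu> (mean n f) x - gradient d (mean n f) x"
    by (simp add: coosge_mean sum_subtractf scaleR_diff_right)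
  also have "(norm \<dots>)\<^sup>2 \<le> L\<^sup>2 * real d * \<mu>\<^sup>2 / 4"
    by (rule coosge_error[OF smooth_mean x \<mu>])
  also have "(\<Sum>i=1..n. (norm (?Y i))\<^sup>2) \<le> (\<Sum>i=1..n. L\<^sup>2 * real d * (norm (x - z i))\<^sup>2)"
    by (intro sum_mono coosge_lipschitz f x z \<mu>) auto
  finally show ?thesis
    by (simp add: divide_right_mono add_diff_eq flip: sum_distrib_left)
qed

text \<open>Condition \<open>c1\<close> lets the descent in the squared step length pay for the
  growth of the table distances caused by the move; \<open>c2\<close> keeps the variance plus the
  surviving distances below the weight \<open>c\<close>.\<close>

lemma expectation_lyapunov_step:
  assumes x: "x \<in> Rn d" and z: "\<And>i. z i \<in> Rn d" and c: "0 \<le> c" and \<beta>: "0 < \<beta>"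
    and c1: "c * (1 + 1 / \<beta>) \<le> 1 / (2 * \<eta>) - L / 2"
    and c2: "L\<^sup>2 * real d * \<eta> / (2 * real b) + c * (1 - 1 / real n) ^ b * (1 + \<beta>) \<le> c"
  shows "measure_pmf.expectation batch (\<lambda>B. lyapunov n f \<psi> c (step (x, z) B))
    \<le> lyapunov n f \<psi> c (x, z) - \<eta> / 2 * (norm (G x))\<^sup>2 + \<eta> * L\<^sup>2 * real d * \<mu>\<^sup>2 / 8"
proof -
  let ?E = "measure_pmf.expectation batch"
  define v where "v B = (1 / real b) *\<^sub>R (\<Sum>i\<leftarrow>B. coosge d \<mu> (f i) x - coosge d \<mu> (f i) (z i))
    + (1 / real n) *\<^sub>R (\<Sum>i=1..n. coosge d \<mu> (f i) (z i))" for B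
  \<comment> \<open>Indicator that table entry \<open>i\<close> survives the batch; a refreshed
    entry equals \<open>x\<close> and has distance 0 before the move.\<close>
  let ?\<chi> = "\<lambda>B i. if i \<in> set B then 0 else 1 :: real"
  let ?e = "\<lambda>B. (norm (v B - gradient d (mean n f) x))\<^sup>2"
  let ?s = "\<lambda>B. \<Sum>i=1..n. ?\<chi> B i * (norm (x - z i))\<^sup>2"
  have v: "v B \<in> Rn d" for B
    unfolding v_def by (rule estimator_in_Rn)
  have split_mean: "(real n * p + q * r) / real n = p + q / real n * r" for p q r
    using n by (simp add: add_divide_distrib)
  have weight: "c * (p * q + r / real n * w) = c * p * q + c * r / real n * w" for p q r w
    by (simp add: distrib_left)
  have pointwise: "lyapunov n f \<psi> c (step (x, z) B)
      \<le> F x - \<eta> / 2 * (norm (G x))\<^sup>2 + \<eta> / 2 * ?e B + c * (1 + \<beta>) / real n * ?s B" for B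
  proof -
    define x' where "x' = prox d \<eta> \<psi> (x - \<eta> *\<^sub>R v B)"
    define z' where "z' i = (if i \<in> set B then x else z i)" for i
    have step: "step (x, z) B = (x', z')"
      by (auto simp: zo_step_def x'_def z'_def v_def)
    have "(norm (x' - z' i))\<^sup>2
        \<le> (1 + 1 / \<beta>) * (norm (x' - x))\<^sup>2 + (1 + \<beta>) * (?\<chi> B i * (norm (x - z i))\<^sup>2)" for i
      using norm2_add_le[OF \<beta>, of "x' - x" "x - z' i"] by (auto simp: z'_def)
    then have "(\<Sum>i=1..n. (norm (x' - z' i))\<^sup>2)
        \<le> (\<Sum>i=1..n. (1 + 1 / \<beta>) * (norm (x' - x))\<^sup>2 + (1 + \<beta>) * (?\<chi> B i * (norm (x - z i))\<^sup>2))"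
      by (intro sum_mono)
    also have "\<dots> = real n * ((1 + 1 / \<beta>) * (norm (x' - x))\<^sup>2) + (1 + \<beta>) * ?s B"
      by (simp add: sum.distrib flip: sum_distrib_left)
    finally have "dist2 x' z'
        \<le> (real n * ((1 + 1 / \<beta>) * (norm (x' - x))\<^sup>2) + (1 + \<beta>) * ?s B) / real n"
      by (rule divide_right_mono) simp
    also have "\<dots> = (1 + 1 / \<beta>) * (norm (x' - x))\<^sup>2 + (1 + \<beta>) / real n * ?s B"
      by (rule split_mean)
    finally have "c * dist2 x' z'
        \<le> c * ((1 + 1 / \<beta>) * (norm (x' - x))\<^sup>2 + (1 + \<beta>) / real n * ?s B)"
      by (rule mult_left_mono[OF _ c])
    also have "\<dots> = c * (1 + 1 / \<beta>) * (norm (x' - x))\<^sup>2 + c * (1 + \<beta>) / real n * ?s B"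
      by (rule weight)
    finally have "c * dist2 x' z'
        \<le> c * (1 + 1 / \<beta>) * (norm (x' - x))\<^sup>2 + c * (1 + \<beta>) / real n * ?s B" .
    moreover have "c * (1 + 1 / \<beta>) * (norm (x' - x))\<^sup>2 \<le> (1 / (2 * \<eta>) - L / 2) * (norm (x' - x))\<^sup>2"
      using c1 by (rule mult_right_mono) simp
    moreover have "F x' \<le> F x - \<eta> / 2 * (norm (G x))\<^sup>2
        - (1 / (2 * \<eta>) - L / 2) * (norm (x' - x))\<^sup>2 + \<eta> / 2 * ?e B"
      unfolding x'_def by (rule objective_prox_step_le[OF \<psi> smooth_mean \<eta> x v])
    ultimately show ?thesis
      unfolding step lyapunov_def by simp
  qed
  have int: "integrable (measure_pmf batch) g" for g :: "nat list \<Rightarrow> real"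
    by (rule integrable_measure_pmf_finite) (rule finite_set_batch)
  have \<chi>: "?E (\<lambda>B. ?\<chi> B i) = (1 - 1 / real n) ^ b" if "i \<in> {1..n}" for i
    using expectation_notin_replicate_pmf[of "{1..n}" i b] that by auto
  have s: "?E ?s = (1 - 1 / real n) ^ b * (\<Sum>i=1..n. (norm (x - z i))\<^sup>2)"
  proof -
    have "?E ?s = (\<Sum>i=1..n. ?E (\<lambda>B. ?\<chi> B i) * (norm (x - z i))\<^sup>2)"
      by (simp add: Bochner_Integration.integral_sum int del: One_nat_def)
    also have "\<dots> = (\<Sum>i=1..n. (1 - 1 / real n) ^ b * (norm (x - z i))\<^sup>2)"
      by (intro sum.cong refl) (simp add: \<chi> del: One_nat_def)
    finally show ?thesis
      by (simp add: sum_distrib_left)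
  qed
  have "?E (\<lambda>B. lyapunov n f \<psi> c (step (x, z) B))
      \<le> ?E (\<lambda>B. F x - \<eta> / 2 * (norm (G x))\<^sup>2 + \<eta> / 2 * ?e B + c * (1 + \<beta>) / real n * ?s B)"
    by (rule expectation_mono_set_pmf[OF finite_set_batch pointwise])
  also have "\<dots> = F x - \<eta> / 2 * (norm (G x))\<^sup>2 + \<eta> / 2 * ?E ?e + c * (1 + \<beta>) / real n * ?E ?s"
    by (subst Bochner_Integration.integral_add[OF int int])+ simp
  also have "\<eta> / 2 * ?E ?e
      \<le> \<eta> / 2 * (L\<^sup>2 * real d * \<mu>\<^sup>2 / 4 + L\<^sup>2 * real d / real b * dist2 x z)"
    unfolding v_def using \<eta> by (intro mult_left_mono expectation_estimator_error x z) auto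
  also have "c * (1 + \<beta>) / real n * ?E ?s = (c * (1 - 1 / real n) ^ b * (1 + \<beta>)) * dist2 x z"
    unfolding s by simp
  finally have "?E (\<lambda>B. lyapunov n f \<psi> c (step (x, z) B))
      \<le> F x - \<eta> / 2 * (norm (G x))\<^sup>2 + \<eta> * L\<^sup>2 * real d * \<mu>\<^sup>2 / 8
        + (L\<^sup>2 * real d * \<eta> / (2 * real b) + c * (1 - 1 / real n) ^ b * (1 + \<beta>)) * dist2 x z"
    by (simp add: algebra_simps)
  also have "\<dots> \<le> F x - \<eta> / 2 * (norm (G x))\<^sup>2 + \<eta> * L\<^sup>2 * real d * \<mu>\<^sup>2 / 8 + c * dist2 x z"
    by (intro add_left_mono mult_right_mono c2 divide_nonneg_nonneg sum_nonneg) auto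
  finally show ?thesis
    by (simp add: lyapunov_def)
qed

text \<open>The one-step descent is averaged over the past and telescoped; the final Lyapunov value
  is at least \<open>m\<close> because its distance term is nonnegative.\<close>

lemma sum_expectation_gradient_mapping_le:
  assumes x0: "x0 \<in> Rn d" and c: "0 \<le> c" and \<beta>: "0 < \<beta>"
    and c1: "c * (1 + 1 / \<beta>) \<le> 1 / (2 * \<eta>) - L / 2"
    and c2: "L\<^sup>2 * real d * \<eta> / (2 * real b) + c * (1 - 1 / real n) ^ b * (1 + \<beta>) \<le> c"
    and lower: "\<And>x. x \<in> Rn d \<Longrightarrow> m \<le> F x"
  shows "\<eta> / 2 * (\<Sum>t<T. measure_pmf.expectation (batches_pmf n b T)
      (\<lambda>Is. (norm (G (iterate d n b f \<psi> \<mu> \<eta> x0 Is t)))\<^sup>2))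
    \<le> F x0 - m + real T * (\<eta> * L\<^sup>2 * real d * \<mu>\<^sup>2 / 8)"
proof -
  let ?E = "measure_pmf.expectation (batches_pmf n b T)"
  let ?R = "lyapunov n f \<psi> c"
  let ?g = "\<lambda>t Is. (norm (G (fst (state x0 Is t))))\<^sup>2"
  define \<epsilon> where "\<epsilon> = \<eta> * L\<^sup>2 * real d * \<mu>\<^sup>2 / 8"
  have fin: "finite (set_pmf (batches_pmf n b T))"
    unfolding batches_pmf_def by (rule finite_set_replicate_pmf) (rule finite_set_batch)
  have int: "integrable (measure_pmf (batches_pmf n b T)) h" for h :: "nat list list \<Rightarrow> real"
    by (rule integrable_measure_pmf_finite) (rule fin)
  have descent: "?E (\<lambda>Is. ?R (state x0 Is (Suc t)))
      \<le> ?E (\<lambda>Is. ?R (state x0 Is t)) - \<eta> / 2 * ?E (?g t) + \<epsilon>" if "t < T" for t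
  proof -
    have "?E (\<lambda>Is. ?R (state x0 Is (Suc t)))
        = ?E (\<lambda>Is. ?R (step (state x0 (take t Is) t) (Is ! t)))"
      by (simp add: zo_proxsaga_Suc zo_proxsaga_take del: zo_proxsaga.simps)
    also have "\<dots> = ?E (\<lambda>Is. measure_pmf.expectation batch (\<lambda>B. ?R (step (state x0 (take t Is) t) B)))"
      unfolding batches_pmf_def
      by (rule expectation_replicate_pmf_nth[OF finite_set_batch that,
            of "\<lambda>xs B. ?R (step (state x0 xs t) B)"])
    also have "\<dots> \<le> ?E (\<lambda>Is. ?R (state x0 Is t) - \<eta> / 2 * ?g t Is + \<epsilon>)"
    proof (rule expectation_mono_set_pmf[OF fin])
      fix Is
      obtain x z where xz: "state x0 Is t = (x, z)"
        by fastforce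
      show "measure_pmf.expectation batch (\<lambda>B. ?R (step (state x0 (take t Is) t) B))
          \<le> ?R (state x0 Is t) - \<eta> / 2 * ?g t Is + \<epsilon>"
        using expectation_lyapunov_step[OF _ _ c \<beta> c1 c2, of x z] state_in_Rn[OF x0, of Is t] xz
        by (simp add: zo_proxsaga_take \<epsilon>_def)
    qed
    also have "\<dots> = ?E (\<lambda>Is. ?R (state x0 Is t)) - \<eta> / 2 * ?E (?g t) + \<epsilon>"
      by (simp add: int)
    finally show ?thesis .
  qed
  have "?E (\<lambda>Is. ?R (state x0 Is k)) + \<eta> / 2 * (\<Sum>t<k. ?E (?g t)) \<le> F x0 + real k * \<epsilon>"
    if "k \<le> T" for k
    using that
  proof (induction k)
    \<comment> \<open>All table entries start at \<open>x0\<close>, so the initial Lyapunov value is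
      \<open>F x0\<close>.\<close>
    case 0
    show ?case
      by (simp add: lyapunov_def)
  next
    case (Suc k)
    have "real (Suc k) * \<epsilon> = real k * \<epsilon> + \<epsilon>"
      by (simp add: algebra_simps)
    with Suc descent[of k] show ?case
      by (simp only: sum.lessThan_Suc distrib_left) simp
  qed
  from this[of T] have "?E (\<lambda>Is. ?R (state x0 Is T)) + \<eta> / 2 * (\<Sum>t<T. ?E (?g t))
      \<le> F x0 + real T * \<epsilon>"
    by simp
  moreover have "?E (\<lambda>Is. m) \<le> ?E (\<lambda>Is. ?R (state x0 Is T))"
  proof (rule expectation_mono_set_pmf[OF fin])
    fix Is
    have "m \<le> F (fst (state x0 Is T))"
      using state_in_Rn[OF x0] by (intro lower) blast
    then show "m \<le> ?R (state x0 Is T)"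
      using c by (simp add: lyapunov_def split_beta sum_nonneg add_increasing2)
  qed
  then have "m \<le> ?E (\<lambda>Is. ?R (state x0 Is T))"
    by simp
  ultimately show ?thesis
    unfolding \<epsilon>_def by linarith
qed

end

subsection \<open>The convergence rate\<close>

text \<open>Bernoulli gives \<open>1 + b / n \<le> (1 + 1 / n) ^ b\<close>, and
  \<open>(1 - 1 / n) * (1 + 1 / n) \<le> 1\<close>.\<close>

lemma power_one_minus_inverse_le:
  assumes "1 \<le> n"
  shows "(1 - 1 / real n) ^ b \<le> 1 / (1 + real b / real n)"
proof -
  let ?p = "(1 - 1 / real n) ^ b"
  have "?p * (1 + real b * (1 / real n)) \<le> ?p * (1 + 1 / real n) ^ b"
    using assms by (intro mult_left_mono Bernoulli_inequality) (auto intro: order_trans[of _ 0])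
  also have "\<dots> = (1 - (1 / real n)\<^sup>2) ^ b"
    by (simp add: power_mult_distrib[symmetric] power2_eq_square algebra_simps)
  also have "\<dots> \<le> 1"
    using assms by (intro power_le_one) (auto simp: power_le_one)
  finally show ?thesis
    by (simp add: pos_le_divide_eq add_pos_nonneg)
qed

text \<open>The weight \<open>c\<close> is the fixed point of \<open>c \<mapsto> L\<^sup>2 d \<eta> / (2 b) + (1 - b / (4 n)) c\<close>.\<close>
lemma lyapunov_weight:
  fixes n b d :: nat and L \<rho> \<eta> c \<beta> :: real
  assumes b: "b \<in> {1..n}" and d: "1 \<le> d" and L: "0 < L" and \<rho>: "0 < \<rho>"
    and cond: "32 * \<rho>\<^sup>2 * (real n)\<^sup>2 / (real b) ^ 3 + \<rho> \<le> 1"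
    and \<eta>: "\<eta> = \<rho> / (L * real d)"
    and c: "c = 2 * real n * L * \<rho> / (real b)\<^sup>2" and \<beta>: "\<beta> = real b / (4 * real n)"
  shows "c * (1 + 1 / \<beta>) \<le> 1 / (2 * \<eta>) - L / 2"
    and "L\<^sup>2 * real d * \<eta> / (2 * real b) + c * (1 - 1 / real n) ^ b * (1 + \<beta>) \<le> c"
proof -
  have pos: "0 < real b" "0 < real n" "0 < real d" "real b \<le> real n" "1 \<le> real d"
    using b d by auto
  define s where "s = \<rho>\<^sup>2 * (real n)\<^sup>2 / (real b) ^ 3"
  \<comment> \<open>Here \<open>1 / \<beta> = 4 * n / b\<close>, and
    \<open>1 \<le> n / b\<close>.\<close>
  have "1 + 1 / \<beta> \<le> 5 * real n / real b"
    using pos by (simp add: \<beta> field_simps)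
  then have "c * (1 + 1 / \<beta>) \<le> c * (5 * real n / real b)"
    using L \<rho> by (intro mult_left_mono) (auto simp: c)
  also have "\<dots> = L / (2 * \<rho>) * (20 * s)"
    using pos L \<rho> by (simp add: c s_def field_simps power2_eq_square power3_eq_cube)
  \<comment> \<open>With \<open>s\<close>, \<open>cond\<close> reads
    \<open>32 * s + \<rho> \<le> 1\<close>, which yields \<open>20 * s \<le> real d - \<rho>\<close>
    because \<open>1 \<le> real d\<close>.\<close>
  also have "\<dots> \<le> L / (2 * \<rho>) * (real d - \<rho>)"
  proof (intro mult_left_mono)
    have "0 \<le> s" "32 * s + \<rho> \<le> 1"
      using cond by (simp_all add: s_def mult_ac)
    then show "20 * s \<le> real d - \<rho>"
      using pos by linarith
  qed (use L \<rho> in auto)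
  also have "\<dots> = 1 / (2 * \<eta>) - L / 2"
    using pos L \<rho> by (simp add: \<eta> field_simps)
  finally show "c * (1 + 1 / \<beta>) \<le> 1 / (2 * \<eta>) - L / 2" .
  define u where "u = real b / real n"
  have \<beta>u: "\<beta> = u / 4"
    by (simp add: \<beta> u_def)
  have u: "0 < u" "u \<le> 1"
    using pos by (auto simp: u_def)
  have "(1 - 1 / real n) ^ b * (1 + \<beta>) \<le> 1 / (1 + u) * (1 + \<beta>)"
    unfolding u_def using b by (intro mult_right_mono power_one_minus_inverse_le) (auto simp: \<beta>)
  \<comment> \<open>For \<open>0 < u \<le> 1\<close> the survival factor \<open>1 / (1 + u)\<close>
    outweighs Young's loss \<open>1 + u / 4\<close>. The contraction by \<open>u / 4\<close> that is
    left exactly pays for the variance term, which equals \<open>c * (u / 4)\<close>.\<close>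
  also have "\<dots> \<le> 1 - u / 4"
  proof -
    have "u * u \<le> u * 1"
      using u by (intro mult_left_mono) auto
    moreover have "(1 - u / 4) * (1 + u) = 1 + 3 / 4 * u - u * u / 4"
      by (simp add: field_simps)
    ultimately have "1 + u / 4 \<le> (1 - u / 4) * (1 + u)"
      using u by linarith
    then show ?thesis
      using u by (simp add: \<beta>u divide_le_eq)
  qed
  finally have "c * ((1 - 1 / real n) ^ b * (1 + \<beta>)) \<le> c * (1 - u / 4)"
    using L \<rho> by (intro mult_left_mono) (auto simp: c)
  moreover have "L\<^sup>2 * real d * \<eta> / (2 * real b) = c * (u / 4)"
    using pos L by (simp add: c u_def \<eta> field_simps power2_eq_square)
  ultimately show "L\<^sup>2 * real d * \<eta> / (2 * real b) + c * (1 - 1 / real n) ^ b * (1 + \<beta>) \<le> c"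
    unfolding mult.assoc right_diff_distrib by linarith
qed

lemma expectation_output_pmf:
  fixes h :: "rvec \<Rightarrow> real"
  assumes "1 \<le> n" "1 \<le> T"
  shows "measure_pmf.expectation (output_pmf d n b T f \<psi> \<mu> \<eta> x0) h
    = (1 / real T) * (\<Sum>t<T. measure_pmf.expectation (batches_pmf n b T)
        (\<lambda>Is. h (iterate d n b f \<psi> \<mu> \<eta> x0 Is t)))"
proof -
  have fin: "finite (set_pmf (batches_pmf n b T))"
    unfolding batches_pmf_def using assms by (intro finite_set_replicate_pmf) simp
  have T: "{..<T} \<noteq> {}"
    using assms by (auto simp: lessThan_empty_iff)
  have "measure_pmf.expectation (output_pmf d n b T f \<psi> \<mu> \<eta> x0) h
      = measure_pmf.expectation (batches_pmf n b T)
          (\<lambda>Is. (\<Sum>t<T. h (iterate d n b f \<psi> \<mu> \<eta> x0 Is t)) / real T)"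
    unfolding output_pmf_def pair_pmf_def using T
    by (simp add: expectation_bind_pmf_finite fin integral_pmf_of_set)
  then show ?thesis
    by (simp add: integrable_measure_pmf_finite[OF fin] Bochner_Integration.integral_sum)
qed

text \<open>The order of quantifiers carries the claim about the O-constant: \<open>C\<close> is
  fixed when only \<open>L\<close> and \<open>K\<close> are known, \<open>K\<close> being the
  constant in the bound on \<mu>.\<close>

theorem theorem3:
  fixes L K :: real
  assumes "0 < L"
  shows "\<exists>C. \<forall>(d::nat) (n::nat) (b::nat) (T::nat) (f::nat \<Rightarrow> rvec \<Rightarrow> real) (\<psi>::rvec \<Rightarrow> real)
      (\<sigma>::real) (\<mu>::real) (\<eta>::real) (\<rho>::real) (\<beta>::real) (p::real) (c::nat \<Rightarrow> real) (\<gamma>::real)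
      (x0::rvec) (x_star::rvec).
    standing_assumptions d n f \<psi> L \<sigma> \<and>
    b \<in> {1..n} \<and> 1 \<le> T \<and> 0 < \<mu> \<and> x0 \<in> Rn d \<and>
    p = 1 - (1 - 1 / real n) ^ b \<and>
    0 < \<beta> \<and>
    c T = 0 \<and> (\<forall>t<T. c t = L\<^sup>2 * real d * \<eta> / real b + c (Suc t) * (1 - p) * (1 + \<beta>)) \<and>
    0 < \<rho> \<and> \<rho> < 1 / 2 \<and> \<eta> = \<rho> / (L * real d) \<and>
    32 * \<rho>\<^sup>2 * (real n)\<^sup>2 / (real b) ^ 3 + \<rho> \<le> 1 \<and>
    \<gamma> = \<eta> / 2 - L * \<eta>\<^sup>2 \<and>
    is_arg_min (objective n f \<psi>) (\<lambda>x. x \<in> Rn d) x_star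
    \<longrightarrow>
    (let E = measure_pmf.expectation (batches_pmf n b T);
         x = iterate d n b f \<psi> \<mu> \<eta> x0;
         g = gradient_mapping d n f \<psi> \<eta>;
         F = objective n f \<psi>;
         E_out = measure_pmf.expectation (output_pmf d n b T f \<psi> \<mu> \<eta> x0) (\<lambda>y. (norm (g y))\<^sup>2);
         gap = E (\<lambda>Is. F (x Is 0) - F x_star)
     in E_out = (1 / real T) * (\<Sum>t<T. E (\<lambda>Is. (norm (g (x Is t)))\<^sup>2)) \<and>
        E_out \<le> gap / (real T * \<gamma>) + L\<^sup>2 * (real d)\<^sup>2 * \<mu>\<^sup>2 * \<eta> / (4 * \<gamma>) \<and>
        (b = nat \<lfloor>real n powr (2 / 3)\<rfloor> \<and> \<rho> = 1 / 8 \<and> \<mu> \<le> K / sqrt (real d * real T) \<longrightarrow>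
          E_out \<le> 64 * real d * L * gap / (3 * real T) + C * (real d / real T)))"
\<comment> \<open>The witness comes from the bias term: for \<open>\<rho> = 1 / 8\<close>,
  \<open>\<eta> / (4 * \<gamma>) \<le> 2 / 3\<close>, and
  \<open>\<mu>\<^sup>2 \<le> K\<^sup>2 / (d * T)\<close>.\<close>
proof (intro exI[of _ "2 / 3 * L\<^sup>2 * K\<^sup>2"] allI impI, elim conjE)
  fix d n b T :: nat and f \<psi> and \<sigma> \<mu> \<eta> \<rho> \<beta> p :: real and c :: "nat \<Rightarrow> real" and \<gamma> x0 x_star
  assume std: "standing_assumptions d n f \<psi> L \<sigma>"
    and b_mem: "b \<in> {1..n}" and T: "1 \<le> T" and \<mu>: "0 < \<mu>" and x0: "x0 \<in> Rn d"
    and \<rho>: "0 < \<rho>" "\<rho> < 1 / 2" and \<eta>_eq: "\<eta> = \<rho> / (L * real d)"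
    and cond: "32 * \<rho>\<^sup>2 * (real n)\<^sup>2 / (real b) ^ 3 + \<rho> \<le> 1"
    and \<gamma>: "\<gamma> = \<eta> / 2 - L * \<eta>\<^sup>2"
    and star: "is_arg_min (objective n f \<psi>) (\<lambda>x. x \<in> Rn d) x_star"
  have d: "1 \<le> d" and n: "1 \<le> n" and L: "0 < L" and \<psi>: "convex_on (Rn d) \<psi>"
    using std by (auto simp: standing_assumptions_def)
  have f: "smooth_on_Rn d L (f i)" if "i \<in> {1..n}" for i
    using std that by (simp add: standing_assumptions_def smooth_on_Rn_def)
  have \<eta>_pos: "0 < \<eta>"
    using \<rho> d L by (simp add: \<eta>_eq)
  interpret zo_saga d n b f \<psi> L \<mu> \<eta>
    by unfold_locales (use n b_mem \<mu> \<eta>_pos \<psi> f in auto)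
  let ?E = "measure_pmf.expectation (batches_pmf n b T)"
  let ?S = "\<Sum>t<T. ?E (\<lambda>Is. (norm (G (iterate d n b f \<psi> \<mu> \<eta> x0 Is t)))\<^sup>2)"
  let ?Eout = "measure_pmf.expectation (output_pmf d n b T f \<psi> \<mu> \<eta> x0) (\<lambda>y. (norm (G y))\<^sup>2)"
  define gap where "gap = F x0 - F x_star"
  have lower: "F x_star \<le> F x" if "x \<in> Rn d" for x
    using star that by (auto simp: is_arg_min_linorder)
  have gap: "0 \<le> gap"
    using lower[OF x0] by (simp add: gap_def)
  have gap_eq: "?E (\<lambda>Is. F (iterate d n b f \<psi> \<mu> \<eta> x0 Is 0) - F x_star) = gap"
    by (simp add: gap_def)
  have Eout: "?Eout = (1 / real T) * ?S"
    using n T by (rule expectation_output_pmf)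
  let ?c = "2 * real n * L * \<rho> / (real b)\<^sup>2"
  let ?\<beta> = "real b / (4 * real n)"
  have sum_le: "\<eta> / 2 * ?S \<le> gap + real T * (\<eta> * L\<^sup>2 * real d * \<mu>\<^sup>2 / 8)"
    unfolding gap_def
    by (rule sum_expectation_gradient_mapping_le[OF x0 _ _
          lyapunov_weight[OF b_mem d L \<rho>(1) cond \<eta>_eq refl refl]])
       (use L \<rho> b_mem in \<open>auto intro: lower\<close>)
  \<comment> \<open>In fact \<open>L * \<eta> = \<rho> / d\<close>; together with
    \<open>\<rho> < 1 / 2\<close> this makes \<gamma> positive.\<close>
  have L\<eta>: "L * \<eta> \<le> \<rho>"
    using d L \<rho> by (simp add: \<eta>_eq divide_le_eq)
  have \<gamma>_eq: "\<gamma> = \<eta> * (1 / 2 - L * \<eta>)"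
    by (simp add: \<gamma> power2_eq_square algebra_simps)
  have \<gamma>_pos: "0 < \<gamma>"
    unfolding \<gamma>_eq using \<eta>_pos L\<eta> \<rho> by simp
  have bound: "?Eout \<le> gap / (real T * \<gamma>) + L\<^sup>2 * (real d)\<^sup>2 * \<mu>\<^sup>2 * \<eta> / (4 * \<gamma>)"
  proof -
    have "\<gamma> * ?S \<le> \<eta> / 2 * ?S"
      using L by (intro mult_right_mono sum_nonneg) (auto simp: \<gamma>)
    also note sum_le
    \<comment> \<open>Since \<open>1 \<le> d\<close>, \<open>d / 8 \<le> d\<^sup>2 / 4\<close>,
      which leads to the stated bias term.\<close>
    also have "gap + real T * (\<eta> * L\<^sup>2 * real d * \<mu>\<^sup>2 / 8)
        \<le> gap + real T * (L\<^sup>2 * (real d)\<^sup>2 * \<mu>\<^sup>2 * \<eta> / 4)"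
    proof (intro add_left_mono mult_left_mono)
      have "(\<eta> * L\<^sup>2 * \<mu>\<^sup>2) * (real d / 8) \<le> (\<eta> * L\<^sup>2 * \<mu>\<^sup>2) * ((real d)\<^sup>2 / 4)"
        using d \<eta>_pos by (intro mult_left_mono) (auto simp: power2_eq_square)
      then show "\<eta> * L\<^sup>2 * real d * \<mu>\<^sup>2 / 8 \<le> L\<^sup>2 * (real d)\<^sup>2 * \<mu>\<^sup>2 * \<eta> / 4"
        by (simp add: mult_ac)
    qed simp
    finally have "?S * \<gamma> \<le> gap + real T * (L\<^sup>2 * (real d)\<^sup>2 * \<mu>\<^sup>2 * \<eta> / 4)"
      by (simp only: mult.commute)
    then have "(1 / real T) * ?S
        \<le> (1 / real T) * ((gap + real T * (L\<^sup>2 * (real d)\<^sup>2 * \<mu>\<^sup>2 * \<eta> / 4)) / \<gamma>)"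
      using \<gamma>_pos by (intro mult_left_mono) (auto simp: pos_le_divide_eq)
    also have "\<dots> = gap / (real T * \<gamma>) + L\<^sup>2 * (real d)\<^sup>2 * \<mu>\<^sup>2 * \<eta> / (4 * \<gamma>)"
      using T \<gamma>_pos by (simp add: field_simps)
    finally show ?thesis
      unfolding Eout .
  qed
  have rate: "?Eout \<le> 64 * real d * L * gap / (3 * real T) + 2 / 3 * L\<^sup>2 * K\<^sup>2 * (real d / real T)"
    if \<rho>8: "\<rho> = 1 / 8" and K: "\<mu> \<le> K / sqrt (real d * real T)"
  proof -
    \<comment> \<open>From \<open>L * \<eta> \<le> 1 / 8\<close> follows
      \<open>1 / 2 - L * \<eta> \<ge> 3 / 8\<close>; with \<open>\<eta> = 1 / (8 * L * d)\<close>
      this produces the factor 64/3.\<close>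
    have \<gamma>38: "3 / 8 * \<eta> \<le> \<gamma>"
      unfolding \<gamma>_eq using \<eta>_pos L\<eta> by (simp add: \<rho>8)
    then have "3 / (64 * L * real d) \<le> \<gamma>"
      by (simp add: \<eta>_eq \<rho>8)
    then have "gap / (real T * \<gamma>) \<le> gap / (real T * (3 / (64 * L * real d)))"
      using gap T L d \<gamma>_pos by (intro divide_left_mono mult_left_mono mult_pos_pos) auto
    also have "\<dots> = 64 * real d * L * gap / (3 * real T)"
      using T by (simp add: field_simps)
    finally have 1: "gap / (real T * \<gamma>) \<le> 64 * real d * L * gap / (3 * real T)" .
    have "\<mu>\<^sup>2 \<le> (K / sqrt (real d * real T))\<^sup>2"
      using K \<mu> by (intro power_mono) auto
    then have \<mu>2: "\<mu>\<^sup>2 \<le> K\<^sup>2 / (real d * real T)"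
      by (simp add: power_divide)
    have "\<eta> / (4 * \<gamma>) \<le> 2 / 3"
      using \<gamma>38 \<gamma>_pos by (simp add: divide_le_eq)
    then have "L\<^sup>2 * (real d)\<^sup>2 * \<mu>\<^sup>2 * (\<eta> / (4 * \<gamma>)) \<le> L\<^sup>2 * (real d)\<^sup>2 * (K\<^sup>2 / (real d * real T)) * (2 / 3)"
      using \<mu>2 \<eta>_pos \<gamma>_pos by (intro mult_mono) auto
    also have "\<dots> = 2 / 3 * L\<^sup>2 * K\<^sup>2 * (real d / real T)"
      using d T by (simp add: field_simps power2_eq_square)
    finally show ?thesis
      using bound 1 by simp
  qed
  show "let E = measure_pmf.expectation (batches_pmf n b T);
         x = iterate d n b f \<psi> \<mu> \<eta> x0;
         g = gradient_mapping d n f \<psi> \<eta>;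
         F = objective n f \<psi>;
         E_out = measure_pmf.expectation (output_pmf d n b T f \<psi> \<mu> \<eta> x0) (\<lambda>y. (norm (g y))\<^sup>2);
         gap = E (\<lambda>Is. F (x Is 0) - F x_star)
     in E_out = (1 / real T) * (\<Sum>t<T. E (\<lambda>Is. (norm (g (x Is t)))\<^sup>2)) \<and>
        E_out \<le> gap / (real T * \<gamma>) + L\<^sup>2 * (real d)\<^sup>2 * \<mu>\<^sup>2 * \<eta> / (4 * \<gamma>) \<and>
        (b = nat \<lfloor>real n powr (2 / 3)\<rfloor> \<and> \<rho> = 1 / 8 \<and> \<mu> \<le> K / sqrt (real d * real T) \<longrightarrow>
          E_out \<le> 64 * real d * L * gap / (3 * real T) + 2 / 3 * L\<^sup>2 * K\<^sup>2 * (real d / real T))"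
    unfolding Let_def gap_eq using Eout bound rate by blast
qed

end
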